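(* Let $\beta>1$, let $I=[0,1)$ and let $T:I\to I$ be the $\beta$-transformation $T(x)=\beta x\pmod 1$. Let $h(T)$ be the topological entropy of $T$ and let $m_0$ be the unique $T$-invariant probability measure of maximal entropy. Then there exists a constant $C_0>0$ such that for every $T$-invariant Borel probability measure $\mu$ on $I$ and every function $f:I\to\mathbb R$ of bounded variation, $$\left|\int f\,d\mu-\int f\,dm_0\right|\le C_0\,\|f\|\,\sqrt{h(T)-h(\mu)},$$ where $\|f\|$ is the bounded variation norm of $f$.
   Context: For a $T$-invariant Borel probability measure $\mu$, $h(\mu)$ denotes the (Kolmogorov–Sinai) entropy of $T$ with respect to $\mu$. The topological entropy is $h(T)=\sup\{h(\mu):\mu\text{ a }T\text{-invariant probability measure}\}$, and $m_0$ is the unique $T$-invariant probability measure attaining this supremum (the Parry measure). The bounded variation norm of $f:I\to\mathbb R$ is $\|f\|=\|f\|_{BV}+\|f\|_{L^1}$, where $\|f\|_{L^1}=\int_I|f(x)|\,dx$ and $\|f\|_{BV}=\sup\sum_{i}|f(x_i)-f(x_{i+1})|$, the supremum being over all finite increasing sequences of points in $I$; $f$ has bounded variation if $\|f\|<\infty$. *)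

theory Defs
  imports "HOL-Probability.Probability"
begin

definition invariant_measures :: "'a measure \<Rightarrow> ('a \<Rightarrow> 'a) \<Rightarrow> 'a measure set" where
  "invariant_measures N T =
     {M. sets M = sets N \<and> prob_space M \<and> T \<in> measurable M M \<and> distr M M T = M}"

definition finite_measurable_partitions :: "'a measure \<Rightarrow> 'a set set set" where
  "finite_measurable_partitions M = {P. finite P \<and> P \<subseteq> sets M \<and> partition_on (space M) P}"

(* Cells of measure zero contribute 0, since the factor measure M A vanishes. *)
definition partition_entropy :: "'a measure \<Rightarrow> 'a set set \<Rightarrow> real" where
  "partition_entropy M P = - (\<Sum>A\<in>P. measure M A * ln (measure M A))"

(* The join of the partitions T^(-i) P for i < n; a is the P-itinerary of a cell. *)
definition iterated_join ::
    "'a measure \<Rightarrow> ('a \<Rightarrow> 'a) \<Rightarrow> 'a set set \<Rightarrow> nat \<Rightarrow> 'a set set" where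
  "iterated_join M T P n =
     {{x \<in> space M. \<forall>i<n. (T ^^ i) x \<in> a i} | a. a \<in> {..<n} \<rightarrow>\<^sub>E P} - {{}}"

(* The limit exists by subadditivity whenever M is a T-invariant probability measure. *)
definition partition_entropy_rate :: "'a measure \<Rightarrow> ('a \<Rightarrow> 'a) \<Rightarrow> 'a set set \<Rightarrow> real" where
  "partition_entropy_rate M T P =
     lim (\<lambda>n. partition_entropy M (iterated_join M T P n) / real n)"

(* Kolmogorov-Sinai entropy *)
definition ks_entropy :: "('a \<Rightarrow> 'a) \<Rightarrow> 'a measure \<Rightarrow> ereal" where
  "ks_entropy T M =
     (SUP P\<in>finite_measurable_partitions M. ereal (partition_entropy_rate M T P))"

(* Topological entropy is taken in its variational form. *)
definition topological_entropy :: "'a measure \<Rightarrow> ('a \<Rightarrow> 'a) \<Rightarrow> ereal" where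
  "topological_entropy N T = (SUP M\<in>invariant_measures N T. ks_entropy T M)"

(* Meaningful only when exactly one invariant measure attains the supremum. *)
definition max_entropy_measure :: "'a measure \<Rightarrow> ('a \<Rightarrow> 'a) \<Rightarrow> 'a measure" where
  "max_entropy_measure N T =
     (THE M. M \<in> invariant_measures N T \<and> ks_entropy T M = topological_entropy N T)"

definition unit_borel :: "real measure" where
  "unit_borel = restrict_space borel {0..<1}"

definition beta_map :: "real \<Rightarrow> real \<Rightarrow> real" where
  "beta_map \<beta> x = frac (\<beta> * x)"

(* Functions on [0,1) are total functions on the reals whose values outside [0,1) are ignored. *)
definition variation :: "(real \<Rightarrow> real) \<Rightarrow> ennreal" where
  "variation f =
     (SUP (n, x) \<in> {(n, x). strict_mono_on {..n} x \<and> x ` {..n} \<subseteq> {0..<1}}.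
        ennreal (\<Sum>i<n. \<bar>f (x i) - f (x (Suc i))\<bar>))"

definition bv_norm :: "(real \<Rightarrow> real) \<Rightarrow> ennreal" where
  "bv_norm f = variation f + (\<integral>\<^sup>+x\<in>{0..<1}. ennreal \<bar>f x\<bar> \<partial>lborel)"

end

theory Submission
  imports Defs
begin

text \<open>
  Write \<open>u\<^sub>s\<close> for the indicator of \<open>[0,s)\<close> and \<open>L\<close> for the transfer operator
  \<open>L \<phi> x = (1/\<beta>) (\<Sum>y \<in> T\<^sup>-\<^sup>1 x. \<phi> y)\<close>. Since \<open>L u\<^sub>s = (\<lfloor>\<beta> s\<rfloor> + u\<^bsub>T s\<^esub>) / \<beta>\<close>, the series
  \<open>w\<^sub>s = (\<Sum>n. \<beta>\<^bsup>-n\<^esup> u\<^bsub>T\<^sup>n s\<^esub>)\<close> satisfies \<open>w\<^sub>s - L w\<^sub>s = u\<^sub>s - s\<close>; in particular \<open>h = w\<^sub>1\<close> is the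
  (unnormalised) Parry density. Summing such series once more yields, for \<open>F = u\<^sub>t - m\<^sub>0 [0,t)\<close>, an
  explicit \<open>V\<close> with \<open>h F = V - L V\<close>, bounded uniformly in \<open>t\<close>; no spectral gap is needed.

  Consequently \<open>\<psi> = h + \<theta> L V\<close> satisfies \<open>L (e\<^bsup>\<theta> F\<^esup> \<psi>) \<le> (1 + c \<theta>\<^sup>2) \<psi>\<close> for small \<open>\<theta>\<close>, so the partition
  function of the potential \<open>\<theta> F\<close> over the \<open>n\<close>-cylinders is \<open>O((\<beta> (1 + c \<theta>\<^sup>2))\<^sup>n)\<close>, and Gibbs' inequality
  gives \<open>h(\<mu>) + \<theta> \<integral>F d\<mu> \<le> ln \<beta> + c \<theta>\<^sup>2\<close>. Optimising in \<open>\<theta>\<close> bounds the discrepancy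
  \<open>\<bar>\<mu> [0,t) - m\<^sub>0 [0,t)\<bar>\<close> by a multiple of \<open>\<surd>(ln \<beta> - h(\<mu>))\<close>, uniformly in \<open>t\<close>. Koksma's inequality extends this to functions of
  bounded variation, and the case of equality shows that \<open>m\<^sub>0\<close> is the only measure of maximal entropy.
\<close>

section \<open>The transfer operator\<close>

text \<open>In general \<open>T^n\<close> does not map a cylinder of rank \<open>n\<close> onto all
  of \<open>[0,1)\<close>, so the preimages of an arbitrary point do not index the cylinders. Those
  of 0 do: each cylinder contains exactly one zero of \<open>T^n\<close>, its left endpoint.
  Partition functions are therefore evaluated at 0 alone, and the transfer operator is controlled at
  every point, not just almost everywhere. The tilt has to be constant on cylinders, so
  \<open>t\<close> is first a zero of some \<open>T^m\<close>. Such points approach any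
  \<open>t\<close> from the left, and the bound survives the limit because its constants do not
  depend on \<open>m\<close>. Entropy is a supremum over arbitrary finite partitions. Instead of a
  reduction to a generator, Gibbs' inequality is applied directly to the itineraries of an arbitrary
  partition, with weights in which the digits guess the cell visited at each time. The constants are
  powers of \<open>K\<close>, the sum of the \<open>(1 / \<beta>) ^ n\<close>: the density is at
  most \<open>K\<close>, \<open>\<bar>V\<bar>\<close> at most \<open>K^2\<close>, and the second
  order error of the tilt \<open>8 * K^3 * \<theta>^2\<close>; optimising against it produces
  \<open>32 * K^3\<close>.\<close>

lemma add_less_iff_less_floor:
  fixes r x :: real
  assumes "0 \<le> x" "x < 1" "0 \<le> r"
  shows "{j::nat. real j + x < r} = {..<nat \<lfloor>r\<rfloor> + of_bool (x < frac r)}"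
proof -
  have r: "r = real (nat \<lfloor>r\<rfloor>) + frac r"
    using assms by (simp add: frac_def)
  have f: "0 \<le> frac r" "frac r < 1"
    by (simp_all add: frac_lt_1)
  show ?thesis
  proof (intro set_eqI)
    fix j :: nat
    consider "j < nat \<lfloor>r\<rfloor>" | "j = nat \<lfloor>r\<rfloor>" | "j > nat \<lfloor>r\<rfloor>"
      by linarith
    then show "j \<in> {j. real j + x < r} \<longleftrightarrow> j \<in> {..<nat \<lfloor>r\<rfloor> + of_bool (x < frac r)}"
    proof cases
      case 1
      then have "real j + 1 \<le> real (nat \<lfloor>r\<rfloor>)" by linarith
      then have "real j + x < r" using assms f r by linarith
      then show ?thesis using 1 by simp
    next
      case 2
      then have "real j + x < r \<longleftrightarrow> x < frac r" using r by linarith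
      then show ?thesis using 2 by simp
    next
      case 3
      then have "real (nat \<lfloor>r\<rfloor>) + 1 \<le> real j" by linarith
      then have "\<not> real j + x < r" using assms f r by linarith
      then show ?thesis using 3 by (simp add: of_bool_def)
    qed
  qed
qed

text \<open>With \<open>r = \<beta> * t\<close> this counts the preimages of \<open>x\<close> below
  \<open>t\<close>, and \<open>frac r\<close> is \<open>T t\<close>. A threshold function thus goes
  to a threshold function under the transfer operator, up to a constant and scaling.\<close>

lemma card_add_less:
  fixes r x :: real
  assumes "0 \<le> x" "x < 1" "0 \<le> r"
  shows "real (card {j::nat. real j + x < r}) = of_int \<lfloor>r\<rfloor> + of_bool (x < frac r)"
  using assms by (simp add: add_less_iff_less_floor)

locale beta_transformation =
  fixes \<beta> :: real
  assumes beta_gt_1 [simp]: "1 < \<beta>"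
begin

abbreviation T :: "real \<Rightarrow> real" where
  "T \<equiv> beta_map \<beta>"

lemma T_ge_0 [simp]: "0 \<le> T x" and T_lt_1 [simp]: "T x < 1"
  by (simp_all add: beta_map_def frac_lt_1)

lemma beta_pos [simp]: "0 < \<beta>" "\<beta> \<noteq> 0" "0 \<le> \<beta>"
  using beta_gt_1 by linarith+

lemma T_funpow_range:
  assumes "0 \<le> s" "s \<le> 1"
  shows "0 \<le> (T ^^ n) s" "(T ^^ n) s \<le> 1"
  using assms by (induction n) (auto simp: less_imp_le)

lemma T_funpow_in: "s \<in> {0..<1} \<Longrightarrow> (T ^^ n) s \<in> {0..<1}"
  by (induction n) auto

definition preimages :: "real \<Rightarrow> real set" where
  "preimages x = {y \<in> {0..<1}. T y = x}"

lemma preimages_less_eq: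
  assumes "0 \<le> x" "x < 1" "t \<le> 1"
  shows "{y \<in> preimages x. y < t} = (\<lambda>j. (real j + x) / \<beta>) ` {j. real j + x < \<beta> * t}"
proof (intro equalityI subsetI)
  fix y assume "y \<in> {y \<in> preimages x. y < t}"
  then have y: "0 \<le> y" "y < t" and "frac (\<beta> * y) = x"
    by (auto simp: preimages_def beta_map_def)
  then have "real (nat \<lfloor>\<beta> * y\<rfloor>) + x = \<beta> * y"
    by (simp add: frac_def)
  then show "y \<in> (\<lambda>j. (real j + x) / \<beta>) ` {j. real j + x < \<beta> * t}"
    using y by (intro image_eqI[of _ _ "nat \<lfloor>\<beta> * y\<rfloor>"]) auto
next
  fix y assume "y \<in> (\<lambda>j. (real j + x) / \<beta>) ` {j. real j + x < \<beta> * t}"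
  then obtain j :: nat where j: "y = (real j + x) / \<beta>" "real j + x < \<beta> * t"
    by auto
  have "frac (real j + x) = x"
    using assms by (simp add: frac_unique_iff)
  then have "T y = x"
    using j by (simp add: beta_map_def)
  moreover have "y < t" "0 \<le> y"
    using j assms by (simp_all add: pos_divide_less_eq mult.commute)
  ultimately show "y \<in> {y \<in> preimages x. y < t}"
    using assms by (auto simp: preimages_def)
qed

lemma inj_branch: "inj_on (\<lambda>j. (real j + x) / \<beta>) A"
  by (auto simp: inj_on_def)

lemma preimages_eq:
  assumes "0 \<le> x" "x < 1"
  shows "preimages x = (\<lambda>j. (real j + x) / \<beta>) ` {j. real j + x < \<beta>}"
proof -
  have "preimages x = {y \<in> preimages x. y < 1}"
    by (auto simp: preimages_def)
  then show ?thesis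
    using preimages_less_eq[OF assms, of 1] by simp
qed

lemma finite_preimages: "finite (preimages x)"
proof (cases "0 \<le> x \<and> x < 1")
  case True
  then show ?thesis
    by (simp add: preimages_eq add_less_iff_less_floor)
next
  case False
  then have "preimages x = {}"
    using T_ge_0 T_lt_1 by (auto simp: preimages_def)
  then show ?thesis by simp
qed

text \<open>A finite sum at each point, not an operator on classes modulo null sets: the partition
  function is later read off at the single point 0.\<close>

definition transfer :: "(real \<Rightarrow> real) \<Rightarrow> real \<Rightarrow> real" where
  "transfer \<phi> x = (\<Sum>y\<in>preimages x. \<phi> y) / \<beta>"

lemma transfer_mono:
  assumes "\<And>y. y \<in> {0..<1} \<Longrightarrow> \<phi> y \<le> \<psi> y"
  shows "transfer \<phi> x \<le> transfer \<psi> x"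
  unfolding transfer_def using assms
  by (intro divide_right_mono sum_mono) (auto simp: preimages_def)

lemma transfer_add: "transfer (\<lambda>y. \<phi> y + \<psi> y) x = transfer \<phi> x + transfer \<psi> x"
  by (simp add: transfer_def sum.distrib add_divide_distrib)

lemma transfer_diff: "transfer (\<lambda>y. \<phi> y - \<psi> y) x = transfer \<phi> x - transfer \<psi> x"
  by (simp add: transfer_def sum_subtractf diff_divide_distrib)

lemma transfer_cmult: "transfer (\<lambda>y. c * \<phi> y) x = c * transfer \<phi> x"
  by (simp add: transfer_def sum_distrib_left)

lemma transfer_less:
  assumes "x \<in> {0..<1}" "0 \<le> t" "t \<le> 1"
  shows "transfer (\<lambda>y. of_bool (y < t)) x = (of_int \<lfloor>\<beta> * t\<rfloor> + of_bool (x < T t)) / \<beta>"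
proof -
  have "(\<Sum>y\<in>preimages x. of_bool (y < t)) = real (card {y \<in> preimages x. y < t})"
    using finite_preimages by (simp add: of_bool_def sum.If_cases Int_def)
  also have "\<dots> = of_int \<lfloor>\<beta> * t\<rfloor> + of_bool (x < T t)"
    using assms by (simp add: preimages_less_eq card_image[OF inj_branch] card_add_less beta_map_def)
  finally show ?thesis by (simp add: transfer_def)
qed

section \<open>Geometric series along orbits: the invariant density and the coboundary\<close>

definition K :: real where
  "K = 1 / (1 - 1 / \<beta>)"

lemma ratio [simp]: "norm (1 / \<beta>) < 1" "\<bar>1 / \<beta>\<bar> < 1"
  by (simp_all add: abs_divide abs_of_pos)

lemma K_gt_1: "1 < K"
  using beta_gt_1 by (simp add: K_def less_divide_eq)

lemma geometric_sums_K: "(\<lambda>n. (1 / \<beta>) ^ n) sums K"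
  unfolding K_def by (rule geometric_sums) simp

lemma summable_series:
  assumes "\<And>n. \<bar>a n\<bar> \<le> B"
  shows "summable (\<lambda>n. (1 / \<beta>) ^ n * a n)"
proof (rule summable_comparison_test)
  show "\<exists>N. \<forall>n\<ge>N. norm ((1 / \<beta>) ^ n * a n) \<le> (1 / \<beta>) ^ n * B"
    using assms by (auto simp: abs_mult abs_divide power_abs intro!: exI[of _ 0] divide_right_mono)
  show "summable (\<lambda>n. (1 / \<beta>) ^ n * B)"
    by (intro summable_mult2 summable_geometric) simp
qed

lemma series_bounds:
  assumes "\<And>n. 0 \<le> a n" "\<And>n. a n \<le> B"
  shows "a 0 \<le> (\<Sum>n. (1 / \<beta>) ^ n * a n)" "(\<Sum>n. (1 / \<beta>) ^ n * a n) \<le> K * B"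
proof -
  have s: "summable (\<lambda>n. (1 / \<beta>) ^ n * a n)"
    using assms by (intro summable_series[of _ B]) auto
  show "a 0 \<le> (\<Sum>n. (1 / \<beta>) ^ n * a n)"
    using sum_le_suminf[OF s, of "{0}"] assms by simp
  show "(\<Sum>n. (1 / \<beta>) ^ n * a n) \<le> K * B"
  proof (rule sums_le)
    show "(\<lambda>n. (1 / \<beta>) ^ n * a n) sums (\<Sum>n. (1 / \<beta>) ^ n * a n)"
      using s by (rule summable_sums)
    show "(\<lambda>n. (1 / \<beta>) ^ n * B) sums (K * B)"
      by (intro sums_mult2 geometric_sums_K)
    show "(1 / \<beta>) ^ n * a n \<le> (1 / \<beta>) ^ n * B" for n
      using assms by (intro mult_left_mono) auto
  qed
qed

lemma transfer_series:
  assumes "\<And>n y. \<bar>\<phi> n y\<bar> \<le> B"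
  shows "transfer (\<lambda>y. \<Sum>n. (1 / \<beta>) ^ n * \<phi> n y) x = (\<Sum>n. (1 / \<beta>) ^ n * transfer (\<phi> n) x)"
proof -
  have s: "summable (\<lambda>n. (1 / \<beta>) ^ n * \<phi> n y)" for y
    using assms by (rule summable_series)
  have "(\<Sum>y\<in>preimages x. \<Sum>n. (1 / \<beta>) ^ n * \<phi> n y) / \<beta>
      = (\<Sum>n. (\<Sum>y\<in>preimages x. (1 / \<beta>) ^ n * \<phi> n y)) / \<beta>"
    using s by (subst suminf_sum) auto
  also have "\<dots> = (\<Sum>n. (\<Sum>y\<in>preimages x. (1 / \<beta>) ^ n * \<phi> n y) / \<beta>)"
    using s by (intro suminf_divide[symmetric] summable_sum) auto
  also have "\<dots> = (\<Sum>n. (1 / \<beta>) ^ n * transfer (\<phi> n) x)"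
    by (simp add: transfer_def sum_distrib_left)
  finally show ?thesis by (simp add: transfer_def)
qed

definition orbit_sum :: "real \<Rightarrow> real \<Rightarrow> real" where
  "orbit_sum s x = (\<Sum>n. (1 / \<beta>) ^ n * of_bool (x < (T ^^ n) s))"

lemma orbit_sum_bounds: "0 \<le> orbit_sum s x" "orbit_sum s x \<le> K"
  unfolding orbit_sum_def using series_bounds[of "\<lambda>n. of_bool (x < (T ^^ n) s)" 1]
  by (auto intro: order_trans[rotated])

text \<open>Because \<open>T t = \<beta> * t - of_int \<lfloor>\<beta> * t\<rfloor>\<close>, the
  constants produced by \<open>transfer_less\<close> telescope to \<open>s\<close>. The indicators
  produced are those of the same series shifted by one place, so just the term \<open>n = 0\<close>
  is lost.\<close>

lemma transfer_orbit_sum: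
  assumes x: "x \<in> {0..<1}" and s: "0 \<le> s" "s \<le> 1"
  shows "transfer (orbit_sum s) x = orbit_sum s x - of_bool (x < s) + s"
proof -
  let ?a = "\<lambda>n. (1 / \<beta>) ^ n * (T ^^ n) s" and ?u = "\<lambda>n. (1 / \<beta>) ^ n * of_bool (x < (T ^^ n) s) :: real"
  have T_eq: "T t = \<beta> * t - of_int \<lfloor>\<beta> * t\<rfloor>" for t
    by (simp add: beta_map_def frac_def)
  have su: "summable ?u"
    by (rule summable_series[of _ 1]) simp
  have "?a \<longlonglongrightarrow> 0"
    using T_funpow_range[OF s] by (intro summable_LIMSEQ_zero summable_series[of _ 1]) auto
  from telescope_sums'[OF this] have "(\<lambda>n. ?a n - ?a (Suc n)) sums s"
    by simp
  moreover have "(\<lambda>n. ?u (Suc n)) sums (orbit_sum s x - of_bool (x < s))"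
    using su by (subst sums_Suc_iff) (auto simp: orbit_sum_def intro!: summable_sums)
  ultimately have "(\<lambda>n. (?a n - ?a (Suc n)) + ?u (Suc n)) sums (s + (orbit_sum s x - of_bool (x < s)))"
    by (rule sums_add)
  moreover have "(?a n - ?a (Suc n)) + ?u (Suc n) = (1 / \<beta>) ^ n * transfer (\<lambda>y. of_bool (y < (T ^^ n) s)) x" for n
  proof -
    have "(T ^^ n) s - T ((T ^^ n) s) / \<beta> = of_int \<lfloor>\<beta> * (T ^^ n) s\<rfloor> / \<beta>"
      by (subst T_eq) (simp add: field_simps)
    then have e: "?a n - ?a (Suc n) = (1 / \<beta>) ^ n * (of_int \<lfloor>\<beta> * (T ^^ n) s\<rfloor> / \<beta>)"
      by (metis (no_types, lifting) funpow.simps(2) o_apply power_Suc2 right_diff_distrib mult.assoc mult_1 times_divide_eq_left)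
    have "transfer (\<lambda>y. of_bool (y < (T ^^ n) s)) x
        = (of_int \<lfloor>\<beta> * (T ^^ n) s\<rfloor> + of_bool (x < (T ^^ Suc n) s)) / \<beta>"
      using T_funpow_range[OF s] x by (simp add: transfer_less)
    then show ?thesis
      unfolding e by (simp add: algebra_simps add_divide_distrib)
  qed
  ultimately have "(\<lambda>n. (1 / \<beta>) ^ n * transfer (\<lambda>y. of_bool (y < (T ^^ n) s)) x)
      sums (s + (orbit_sum s x - of_bool (x < s)))"
    by simp
  then show ?thesis
    unfolding orbit_sum_def by (subst transfer_series[of _ 1]) (auto simp: sums_iff)
qed

definition parry_density :: "real \<Rightarrow> real" where
  "parry_density = orbit_sum 1"

text \<open>The integral of \<open>parry_density\<close> over \<open>[0,t)\<close>, term by term. It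
  is not normalised: \<open>parry_cdf 1\<close> is the total mass.\<close>

definition parry_cdf :: "real \<Rightarrow> real" where
  "parry_cdf t = (\<Sum>m. (1 / \<beta>) ^ m * min t ((T ^^ m) 1))"

lemma parry_density_bounds: "x < 1 \<Longrightarrow> 1 \<le> parry_density x" "0 \<le> parry_density x" "parry_density x \<le> K"
proof -
  show "x < 1 \<Longrightarrow> 1 \<le> parry_density x"
    using series_bounds(1)[of "\<lambda>n. of_bool (x < (T ^^ n) 1)" 1]
    by (simp add: parry_density_def orbit_sum_def)
qed (auto simp: parry_density_def orbit_sum_bounds)

text \<open>For \<open>s = 1\<close> the indicator in \<open>transfer_orbit_sum\<close> is 1 on
  \<open>[0,1)\<close> and cancels the constant \<open>s\<close>.\<close>

lemma transfer_parry_density: "x \<in> {0..<1} \<Longrightarrow> transfer parry_density x = parry_density x"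
  by (simp add: parry_density_def transfer_orbit_sum)

lemma parry_cdf_bounds:
  assumes "0 \<le> t" "t \<le> 1"
  shows "t \<le> parry_cdf t" "parry_cdf t \<le> K" "parry_cdf t \<le> parry_cdf 1"
proof -
  have T1: "0 \<le> (T ^^ m) 1" "(T ^^ m) 1 \<le> 1" for m
    using T_funpow_range[of 1 m] by auto
  show "t \<le> parry_cdf t" "parry_cdf t \<le> K"
    unfolding parry_cdf_def
    using series_bounds[of "\<lambda>m. min t ((T ^^ m) 1)" 1] T1 assms by (auto simp: min_def split: if_splits)
  show "parry_cdf t \<le> parry_cdf 1"
    unfolding parry_cdf_def using T1 assms
    by (intro suminf_le mult_left_mono summable_series[of _ 1]) (auto simp: min_def)
qed

text \<open>The product \<open>parry_density x * of_bool (x < t)\<close> is the series of the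
  indicators of \<open>x < min t ((T ^^ m) 1)\<close>. Replacing each of them by its orbit sum
  solves the coboundary equation for the product, up to the constant
  \<open>parry_cdf t\<close>.\<close>

definition orbit_double_sum :: "real \<Rightarrow> real \<Rightarrow> real" where
  "orbit_double_sum t x = (\<Sum>m. (1 / \<beta>) ^ m * orbit_sum (min t ((T ^^ m) 1)) x)"

lemma orbit_double_sum_bounds: "0 \<le> orbit_double_sum t x" "orbit_double_sum t x \<le> K * K"
  unfolding orbit_double_sum_def
  using series_bounds[of "\<lambda>m. orbit_sum (min t ((T ^^ m) 1)) x" K] orbit_sum_bounds
  by (auto intro: order_trans[rotated])

lemma transfer_orbit_double_sum:
  assumes x: "x \<in> {0..<1}" and t: "0 \<le> t" "t \<le> 1"
  shows "transfer (orbit_double_sum t) x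
    = orbit_double_sum t x - parry_density x * of_bool (x < t) + parry_cdf t"
proof -
  have T1: "0 \<le> (T ^^ m) 1" "(T ^^ m) 1 \<le> 1" for m
    using T_funpow_range[of 1 m] by auto
  have "(\<lambda>m. (1 / \<beta>) ^ m * orbit_sum (min t ((T ^^ m) 1)) x) sums orbit_double_sum t x"
    unfolding orbit_double_sum_def using orbit_sum_bounds
    by (intro summable_sums summable_series[of _ K]) auto
  moreover have "(\<lambda>m. (1 / \<beta>) ^ m * of_bool (x < (T ^^ m) 1) * of_bool (x < t))
      sums (parry_density x * of_bool (x < t))"
    unfolding parry_density_def orbit_sum_def
    by (intro sums_mult2 summable_sums summable_series[of _ 1]) auto
  moreover have "(\<lambda>m. (1 / \<beta>) ^ m * min t ((T ^^ m) 1)) sums parry_cdf t"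
    unfolding parry_cdf_def using T1 t by (intro summable_sums summable_series[of _ 1]) auto
  ultimately have "(\<lambda>m. (1 / \<beta>) ^ m * orbit_sum (min t ((T ^^ m) 1)) x
        - (1 / \<beta>) ^ m * of_bool (x < (T ^^ m) 1) * of_bool (x < t)
        + (1 / \<beta>) ^ m * min t ((T ^^ m) 1))
      sums (orbit_double_sum t x - parry_density x * of_bool (x < t) + parry_cdf t)"
    by (intro sums_add sums_diff)
  moreover have "(1 / \<beta>) ^ m * orbit_sum (min t ((T ^^ m) 1)) x
        - (1 / \<beta>) ^ m * of_bool (x < (T ^^ m) 1) * of_bool (x < t)
        + (1 / \<beta>) ^ m * min t ((T ^^ m) 1)
      = (1 / \<beta>) ^ m * transfer (orbit_sum (min t ((T ^^ m) 1))) x" for m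
  proof -
    have "transfer (orbit_sum (min t ((T ^^ m) 1))) x = orbit_sum (min t ((T ^^ m) 1)) x
        - of_bool (x < (T ^^ m) 1) * of_bool (x < t) + min t ((T ^^ m) 1)"
      using transfer_orbit_sum[OF x, of "min t ((T ^^ m) 1)"] T1[of m] t
      by (simp add: of_bool_conj mult.commute)
    then show ?thesis by (simp only: distrib_left right_diff_distrib mult.assoc)
  qed
  ultimately show ?thesis
    unfolding orbit_double_sum_def using orbit_sum_bounds
    by (subst transfer_series[of _ K]) (auto simp: sums_iff)
qed

end

section \<open>Cylinders and the tilted partition function\<close>

lemma exp_le_quadratic:
  fixes x :: real
  assumes "\<bar>x\<bar> \<le> 1"
  shows "exp x \<le> 1 + x + x\<^sup>2"
proof (cases "0 \<le> x")
  case True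
  then show ?thesis using exp_bound[of x] assms by auto
next
  case False
  define y where "y = - x"
  have y: "0 \<le> y" "y \<le> 1" using False assms by (auto simp: y_def)
  have pos: "0 \<le> 1 - y + y\<^sup>2" using y by (simp add: power2_eq_square)
  \<comment> \<open>For \<open>x = - y\<close> the claim is
    \<open>1 \<le> (1 - y + y\<^sup>2) * exp y\<close>. The quadratic lower bound for
    \<open>exp y\<close> suffices, since the product of the two polynomials exceeds 1 by exactly
    \<open>(y ^ 2 + y ^ 3 + y ^ 4) / 2\<close>.\<close>
  have "1 \<le> 1 + (y ^ 2 + y ^ 3 + y ^ 4) / 2" using y by simp
  also have "\<dots> = (1 - y + y\<^sup>2) * (1 + y + y\<^sup>2 / 2)"
    by (simp add: field_simps power2_eq_square power3_eq_cube power4_eq_xxxx)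
  also have "\<dots> \<le> (1 - y + y\<^sup>2) * exp y"
    using exp_lower_Taylor_quadratic[OF y(1)] pos by (intro mult_left_mono)
  finally have "exp (- y) \<le> (1 - y + y\<^sup>2)"
    by (simp add: exp_minus inverse_eq_divide divide_le_eq)
  then show ?thesis by (simp add: y_def)
qed

context beta_transformation
begin

lemma beta_transfer: "\<beta> * transfer \<phi> x = (\<Sum>y\<in>preimages x. \<phi> y)"
  by (simp add: transfer_def)

lemma beta_mult_eq: "\<beta> * x = of_int \<lfloor>\<beta> * x\<rfloor> + T x"
  by (simp add: beta_map_def frac_def)

lemma T_0 [simp]: "T 0 = 0"
  by (simp add: beta_map_def)

lemma T_funpow_0 [simp]: "(T ^^ n) 0 = 0"
  by (induction n) auto

lemma T_funpow_Suc: "(T ^^ Suc n) x = (T ^^ n) (T x)"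
  by (simp add: funpow_swap1)

text \<open>The left endpoint of the cylinder of rank \<open>n\<close> containing \<open>x\<close>; it serves as the sample point of the cylinder.\<close>

primrec left_end :: "nat \<Rightarrow> real \<Rightarrow> real" where
  "left_end 0 x = 0"
| "left_end (Suc n) x = (of_int \<lfloor>\<beta> * x\<rfloor> + left_end n (T x)) / \<beta>"

lemma left_end_bounds:
  assumes "x \<in> {0..<1}"
  shows "0 \<le> left_end n x" "left_end n x \<le> x" "x < left_end n x + (1 / \<beta>) ^ n"
proof -
  have "0 \<le> left_end n x \<and> left_end n x \<le> x \<and> x < left_end n x + (1 / \<beta>) ^ n"
    using assms
  proof (induction n arbitrary: x)
    case (Suc n)
    then have IH: "0 \<le> left_end n (T x)" "left_end n (T x) \<le> T x" "T x < left_end n (T x) + (1 / \<beta>) ^ n"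
      by auto
    have "0 \<le> \<lfloor>\<beta> * x\<rfloor>" using Suc.prems by simp
    then have "0 \<le> of_int \<lfloor>\<beta> * x\<rfloor> + left_end n (T x)"
      using IH(1) by linarith
    then have "0 \<le> left_end (Suc n) x"
      by simp
    moreover have "left_end (Suc n) x \<le> x"
      using IH beta_mult_eq[of x] by (simp add: divide_le_eq mult.commute)
    moreover have "\<beta> * x < \<beta> * (left_end (Suc n) x + (1 / \<beta>) ^ Suc n)"
    proof -
      have "\<beta> * (left_end (Suc n) x + (1 / \<beta>) ^ Suc n)
          = (of_int \<lfloor>\<beta> * x\<rfloor> + left_end n (T x)) + (1 / \<beta>) ^ n"
        by (simp only: left_end.simps power_Suc distrib_left) simp
      then show ?thesis using IH(3) beta_mult_eq[of x] by linarith
    qed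
    then have "x < left_end (Suc n) x + (1 / \<beta>) ^ Suc n"
      using mult_less_cancel_left_pos[OF beta_pos(1)] by blast
    ultimately show ?case by blast
  qed auto
  then show "0 \<le> left_end n x" "left_end n x \<le> x" "x < left_end n x + (1 / \<beta>) ^ n"
    by auto
qed

lemma left_end_in: "x \<in> {0..<1} \<Longrightarrow> left_end n x \<in> {0..<1}"
  using left_end_bounds[of x n] by auto

lemma floor_beta_left_end:
  assumes "x \<in> {0..<1}"
  shows "\<lfloor>\<beta> * left_end (Suc n) x\<rfloor> = \<lfloor>\<beta> * x\<rfloor>"
  using left_end_in[of "T x" n] by (intro floor_unique) auto

lemma T_left_end:
  assumes "x \<in> {0..<1}"
  shows "T (left_end (Suc n) x) = left_end n (T x)"
  using beta_mult_eq[of "left_end (Suc n) x"] floor_beta_left_end[OF assms, of n] by simp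

lemma T_funpow_left_end:
  assumes "x \<in> {0..<1}" "i \<le> n"
  shows "(T ^^ i) (left_end n x) = left_end (n - i) ((T ^^ i) x)"
  using assms
proof (induction i arbitrary: n x)
  case (Suc i)
  then obtain m where n: "n = Suc m" "i \<le> m" by (metis Suc_le_D Suc_le_mono)
  have "(T ^^ Suc i) (left_end n x) = (T ^^ i) (left_end m (T x))"
    using Suc.prems n by (simp only: T_funpow_Suc T_left_end)
  also have "\<dots> = left_end (m - i) ((T ^^ i) (T x))"
    using Suc.IH[of "T x" m] n by simp
  finally show ?case using n by (simp only: T_funpow_Suc diff_Suc_Suc)
qed auto

lemma T_funpow_left_end_0: "x \<in> {0..<1} \<Longrightarrow> (T ^^ n) (left_end n x) = 0"
  by (simp add: T_funpow_left_end)

lemma left_end_left_end: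
  assumes "x \<in> {0..<1}" "k \<le> n"
  shows "left_end k (left_end n x) = left_end k x"
  using assms
proof (induction k arbitrary: n x)
  case (Suc k)
  then obtain m where n: "n = Suc m" "k \<le> m" by (metis Suc_le_D Suc_le_mono)
  have "left_end (Suc k) (left_end n x)
      = (of_int \<lfloor>\<beta> * left_end n x\<rfloor> + left_end k (T (left_end n x))) / \<beta>" by simp
  also have "\<dots> = (of_int \<lfloor>\<beta> * x\<rfloor> + left_end k (left_end m (T x))) / \<beta>"
    using Suc.prems unfolding n by (simp only: floor_beta_left_end T_left_end)
  also have "\<dots> = left_end (Suc k) x"
    using Suc.IH[of "T x" m] n by simp
  finally show ?case .
qed auto

text \<open>The order is lexicographic in the digits: a larger first digit contributes at least 1,
  which the endpoint of the remaining digits, lying in \<open>[0,1)\<close>, cannot make up.\<close>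

lemma left_end_mono:
  assumes "x \<in> {0..<1}" "y \<in> {0..<1}" "x \<le> y"
  shows "left_end n x \<le> left_end n y"
  using assms
proof (induction n arbitrary: x y)
  case (Suc n)
  have fl: "\<lfloor>\<beta> * x\<rfloor> \<le> \<lfloor>\<beta> * y\<rfloor>"
    using Suc.prems by (intro floor_mono mult_left_mono) auto
  have "of_int \<lfloor>\<beta> * x\<rfloor> + left_end n (T x) \<le> of_int \<lfloor>\<beta> * y\<rfloor> + left_end n (T y)"
  proof (cases "\<lfloor>\<beta> * x\<rfloor> = \<lfloor>\<beta> * y\<rfloor>")
    case True
    have "\<beta> * x \<le> \<beta> * y" using Suc.prems by (intro mult_left_mono) auto
    moreover have "\<beta> * x = of_int \<lfloor>\<beta> * y\<rfloor> + T x"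
      using True beta_mult_eq[of x] by simp
    ultimately have "T x \<le> T y"
      using beta_mult_eq[of y] by linarith
    then show ?thesis using True Suc.IH[of "T x" "T y"] by simp
  next
    case False
    then have "of_int \<lfloor>\<beta> * x\<rfloor> + 1 \<le> (of_int \<lfloor>\<beta> * y\<rfloor> :: real)" using fl by linarith
    then show ?thesis using left_end_in[of "T x" n] left_end_in[of "T y" n] by auto
  qed
  then show ?case by (simp add: divide_right_mono)
qed auto

text \<open>Together with \<open>T_funpow_left_end_0\<close>: the zeros of \<open>T ^^ n\<close> in
  \<open>[0,1)\<close> are exactly the left endpoints of rank \<open>n\<close>.\<close>

lemma left_end_fixed:
  assumes "x \<in> {0..<1}" "(T ^^ n) x = 0"
  shows "left_end n x = x"
  using assms
proof (induction n arbitrary: x)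
  case (Suc n)
  then have "left_end n (T x) = T x"
    by (intro Suc.IH) (auto simp: T_funpow_Suc simp del: funpow.simps)
  then show ?case using beta_mult_eq[of x] by (simp add: divide_eq_eq mult.commute)
qed auto

text \<open>Such a \<open>t\<close> is itself a left endpoint of every rank
  \<open>n \<ge> m\<close>, so by monotonicity no cylinder of these ranks straddles it.\<close>

lemma less_iff_left_end_less:
  assumes "t \<in> {0..<1}" "(T ^^ m) t = 0" "m \<le> n" "x \<in> {0..<1}"
  shows "left_end n x < t \<longleftrightarrow> x < t"
proof -
  have "(T ^^ n) t = (T ^^ (n - m)) ((T ^^ m) t)"
    using assms(3) by (simp flip: funpow_add comp_apply[of "T ^^ _" "T ^^ _"])
  then have "left_end n t = t"
    using assms by (intro left_end_fixed) auto
  then show ?thesis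
    using left_end_mono[of t x n] left_end_bounds(2)[of x n] assms by force
qed

lemma T_measurable [measurable]: "T \<in> borel_measurable borel"
  unfolding beta_map_def[abs_def] frac_def by measurable

lemma left_end_measurable [measurable]: "left_end n \<in> borel_measurable borel"
  by (induction n) simp_all

section \<open>Zeros of the iterates and the partition function\<close>

definition preimages_pow :: "nat \<Rightarrow> real \<Rightarrow> real set" where
  "preimages_pow n x = {y \<in> {0..<1}. (T ^^ n) y = x}"

lemma left_end_preimages: "x \<in> {0..<1} \<Longrightarrow> left_end n x \<in> preimages_pow n 0"
  using left_end_in[of x n] by (simp add: preimages_pow_def T_funpow_left_end_0)

lemma preimages_pow_Suc: "preimages_pow (Suc n) x = (\<Union>z\<in>preimages x. preimages_pow n z)"
  using T_funpow_in[of _ n] by (auto simp: preimages_pow_def preimages_def)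

lemma finite_preimages_pow: "finite (preimages_pow n x)"
proof (induction n arbitrary: x)
  case 0
  have "preimages_pow 0 x \<subseteq> {x}" by (auto simp: preimages_pow_def)
  then show ?case by (rule finite_subset) simp
qed (simp add: preimages_pow_Suc finite_preimages)

text \<open>The sum is the \<open>n\<close>-th iterate of the weighted transfer operator, without
  its factors \<open>1 / \<beta>\<close>, applied to \<open>\<psi>\<close>. Each application costs
  at most a factor \<open>\<beta> * c\<close>; the induction peels off the last point
  \<open>z\<close> of the orbit before \<open>x\<close>.\<close>

lemma partition_function_le:
  assumes \<psi>: "\<And>y. y \<in> {0..<1} \<Longrightarrow> transfer (\<lambda>y. exp (\<phi> y) * \<psi> y) y \<le> c * \<psi> y"
    and c: "0 \<le> c" and x: "x \<in> {0..<1}"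
  shows "(\<Sum>y\<in>preimages_pow n x. exp (\<Sum>i<n. \<phi> ((T ^^ i) y)) * \<psi> y) \<le> (\<beta> * c) ^ n * \<psi> x"
  using x
proof (induction n arbitrary: x)
  case 0
  then have "preimages_pow 0 x = {x}" by (auto simp: preimages_pow_def)
  then show ?case by simp
next
  case (Suc n)
  let ?Z = "\<lambda>n x. \<Sum>y\<in>preimages_pow n x. exp (\<Sum>i<n. \<phi> ((T ^^ i) y)) * \<psi> y"
  have "?Z (Suc n) x = (\<Sum>z\<in>preimages x. \<Sum>y\<in>preimages_pow n z. exp (\<Sum>i<Suc n. \<phi> ((T ^^ i) y)) * \<psi> y)"
    unfolding preimages_pow_Suc using finite_preimages finite_preimages_pow
    by (intro sum.UNION_disjoint) (auto simp: preimages_pow_def)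
  also have "\<dots> = (\<Sum>z\<in>preimages x. exp (\<phi> z) * ?Z n z)"
    by (intro sum.cong refl) (auto simp: preimages_pow_def sum_distrib_left exp_add mult_ac intro!: sum.cong)
  also have "\<dots> \<le> (\<Sum>z\<in>preimages x. exp (\<phi> z) * ((\<beta> * c) ^ n * \<psi> z))"
    using Suc.IH by (intro sum_mono mult_left_mono) (auto simp: preimages_def)
  also have "\<dots> = (\<beta> * c) ^ n * (\<beta> * transfer (\<lambda>y. exp (\<phi> y) * \<psi> y) x)"
    unfolding beta_transfer by (simp add: sum_distrib_left mult_ac)
  also have "\<dots> \<le> (\<beta> * c) ^ n * (\<beta> * (c * \<psi> x))"
    using \<psi>[OF Suc.prems] c by (intro mult_left_mono) auto
  finally show ?case by (simp add: mult_ac)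
qed

definition centred_indicator :: "real \<Rightarrow> real \<Rightarrow> real" where
  "centred_indicator t y = of_bool (y < t) - parry_cdf t / parry_cdf 1"

lemma abs_centred_indicator:
  assumes "0 \<le> t" "t \<le> 1"
  shows "\<bar>centred_indicator t y\<bar> \<le> 1"
proof -
  have "1 \<le> parry_cdf 1" "0 \<le> parry_cdf t" "parry_cdf t \<le> parry_cdf 1"
    using parry_cdf_bounds[OF assms] parry_cdf_bounds(1)[of 1] assms by linarith+
  then have "0 \<le> parry_cdf t / parry_cdf 1" "parry_cdf t / parry_cdf 1 \<le> 1"
    by auto
  then show ?thesis unfolding centred_indicator_def of_bool_def by (auto simp del: divide_le_eq_1 zero_le_divide_iff)
qed

text \<open>To first order in \<open>\<theta>\<close>, the factor \<open>exp (\<theta> * F)\<close>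
  changes \<open>h + \<theta> * U\<close> into
  \<open>h + \<theta> * (U + h * F) = h + \<theta> * V\<close>, and the transfer operator sends this
  back to \<open>h + \<theta> * U\<close> because \<open>U\<close> is the transfer of
  \<open>V\<close>. Only terms of order \<open>\<theta>\<^sup>2\<close> remain. The range of
  \<open>\<theta>\<close> is chosen so that \<open>\<bar>\<theta> * U\<bar> \<le> 1 / 2\<close>,
  which keeps \<open>\<psi>\<close> at least \<open>1 / 2\<close>.\<close>

lemma tilted_subinvariant:
  assumes t: "0 \<le> t" "t \<le> 1" and th: "\<bar>\<theta>\<bar> \<le> 1 / (4 * (K * K))"
  obtains \<psi> where "\<And>y. y \<in> {0..<1} \<Longrightarrow> 1 / 2 \<le> \<psi> y" "\<psi> 0 \<le> 3 * (K * K)"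
    "\<And>y. y \<in> {0..<1} \<Longrightarrow>
       transfer (\<lambda>y. exp (\<theta> * centred_indicator t y) * \<psi> y) y \<le> (1 + 8 * K ^ 3 * \<theta>\<^sup>2) * \<psi> y"
proof -
  define F where "F = centred_indicator t"
  define M where "M = K * K"
  define p where "p = parry_cdf t / parry_cdf 1"
  define V where "V y = orbit_double_sum t y - p * orbit_double_sum 1 y" for y
  define U where "U = transfer V"
  let ?h = parry_density
  have M: "1 \<le> M" "K \<le> M"
    using K_gt_1 mult_mono[of 1 K 1 K] mult_mono[of 1 K K K] by (simp_all add: M_def)
  have c1: "1 \<le> parry_cdf 1" and p: "0 \<le> p" "p \<le> 1"
    using parry_cdf_bounds[OF t] parry_cdf_bounds(1)[of 1] t by (auto simp: p_def)
  \<comment> \<open>\<open>p\<close> is the value for which the constants \<open>parry_cdf t\<close>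
    and \<open>p * parry_cdf 1\<close> cancel.\<close>
  have U_eq: "U y = V y - ?h y * F y" if "y \<in> {0..<1}" for y
  proof -
    have "parry_cdf t = p * parry_cdf 1" using c1 by (simp add: p_def)
    moreover have "of_bool (y < t) = F y + p" by (simp add: F_def centred_indicator_def p_def)
    moreover have "U y = orbit_double_sum t y - ?h y * of_bool (y < t) + parry_cdf t
        - p * (orbit_double_sum 1 y - ?h y + parry_cdf 1)"
      using that t unfolding U_def V_def
      by (simp add: transfer_diff transfer_cmult transfer_orbit_double_sum)
    ultimately show ?thesis
      unfolding V_def by (simp only: algebra_simps)
  qed
  have V: "\<bar>V y\<bar> \<le> M" for y
  proof -
    have "0 \<le> p * orbit_double_sum 1 y" "p * orbit_double_sum 1 y \<le> 1 * M"
      using p orbit_double_sum_bounds[of 1 y] mult_mono[of p 1 "orbit_double_sum 1 y" "K * K"] unfolding M_def by auto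
    then show ?thesis
      using orbit_double_sum_bounds[of t y] unfolding V_def M_def by linarith
  qed
  have F: "\<bar>F y\<bar> \<le> 1" for y
    using abs_centred_indicator[OF t] by (simp add: F_def)
  have U: "\<bar>U y\<bar> \<le> 2 * M" if "y \<in> {0..<1}" for y
  proof -
    have "\<bar>?h y * F y\<bar> \<le> K * 1"
      unfolding abs_mult using F parry_density_bounds[of y] by (intro mult_mono) auto
    then show ?thesis using V[of y] U_eq[OF that] M by linarith
  qed
  have th1: "\<bar>\<theta>\<bar> \<le> 1"
  proof -
    have "1 / (4 * M) \<le> 1" using M by simp
    then show ?thesis using th unfolding M_def by linarith
  qed
  have thU: "\<bar>\<theta> * U y\<bar> \<le> 1 / 2" if "y \<in> {0..<1}" for y
  proof -
    have "\<bar>\<theta>\<bar> * \<bar>U y\<bar> \<le> 1 / (4 * M) * (2 * M)"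
      using th U[OF that] M unfolding M_def by (intro mult_mono) auto
    then show ?thesis using M by (simp add: abs_mult)
  qed
  define \<psi> where "\<psi> y = ?h y + \<theta> * U y" for y
  have \<psi>_lower: "1 / 2 \<le> \<psi> y" if "y \<in> {0..<1}" for y
    using thU[OF that] parry_density_bounds(1)[of y] that unfolding \<psi>_def by auto
  have \<psi>_upper: "\<psi> 0 \<le> 3 * M"
    using thU[of 0] parry_density_bounds(3)[of 0] M unfolding \<psi>_def by auto
  \<comment> \<open>The density is invariant and at least 1 on \<open>[0,1)\<close>, hence it
    majorises all transfers of the constant 1.\<close>
  have L1: "transfer (\<lambda>_. 1) x \<le> K" if "x \<in> {0..<1}" for x
  proof -
    have "transfer (\<lambda>_. 1) x \<le> transfer ?h x"
      using parry_density_bounds by (intro transfer_mono) auto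
    then show ?thesis using transfer_parry_density[OF that] parry_density_bounds[of x] by simp
  qed
  have "transfer (\<lambda>y. exp (\<theta> * F y) * \<psi> y) x \<le> (1 + 8 * (M * K) * \<theta>\<^sup>2) * \<psi> x" if x: "x \<in> {0..<1}" for x
  proof -
    have "transfer (\<lambda>y. exp (\<theta> * F y) * \<psi> y) x \<le> transfer (\<lambda>y. (?h y + \<theta> * V y) + (4 * M * \<theta>\<^sup>2) * 1) x"
    proof (rule transfer_mono)
      fix y :: real assume y: "y \<in> {0..<1}"
      have "\<bar>\<theta> * F y\<bar> \<le> 1 * 1"
        unfolding abs_mult using th1 F by (intro mult_mono) auto
      then have "exp (\<theta> * F y) \<le> 1 + \<theta> * F y + (\<theta> * F y)\<^sup>2"
        by (intro exp_le_quadratic) auto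
      moreover have "(\<theta> * F y)\<^sup>2 \<le> \<theta>\<^sup>2 * 1"
        unfolding power_mult_distrib using F[of y] by (intro mult_left_mono) (auto simp: abs_square_le_1)
      ultimately have "exp (\<theta> * F y) * \<psi> y \<le> (1 + \<theta> * F y + \<theta>\<^sup>2) * \<psi> y"
        using \<psi>_lower[OF y] by (intro mult_right_mono) auto
      also have "\<dots> = ?h y + \<theta> * (U y + ?h y * F y) + \<theta>\<^sup>2 * (?h y + F y * U y + \<theta> * U y)"
        by (simp add: \<psi>_def algebra_simps power2_eq_square)
      also have "\<dots> = ?h y + \<theta> * V y + \<theta>\<^sup>2 * (?h y + F y * U y + \<theta> * U y)"
        using U_eq[OF y] by simp
      \<comment> \<open>The \<open>4 * M\<close> adds up \<open>h \<le> K \<le> M\<close>,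
        \<open>\<bar>F * U\<bar> \<le> 2 * M\<close> and
        \<open>\<bar>\<theta> * U\<bar> \<le> 1 / 2 \<le> M\<close>.\<close>
      also have "\<dots> \<le> ?h y + \<theta> * V y + \<theta>\<^sup>2 * (4 * M)"
      proof -
        have "\<bar>F y * U y\<bar> \<le> 1 * (2 * M)"
          unfolding abs_mult using F U[OF y] by (intro mult_mono) auto
        then have "?h y + F y * U y + \<theta> * U y \<le> 4 * M"
          using thU[OF y] parry_density_bounds(3)[of y] M by linarith
        then have "\<theta>\<^sup>2 * (?h y + F y * U y + \<theta> * U y) \<le> \<theta>\<^sup>2 * (4 * M)"
          by (rule mult_left_mono) simp
        then show ?thesis by simp
      qed
      finally show "exp (\<theta> * F y) * \<psi> y \<le> (?h y + \<theta> * V y) + (4 * M * \<theta>\<^sup>2) * 1"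
        by (simp add: mult_ac)
    qed
    also have "\<dots> = \<psi> x + 4 * M * \<theta>\<^sup>2 * transfer (\<lambda>_. 1) x"
      unfolding transfer_add transfer_cmult transfer_parry_density[OF x] by (simp add: \<psi>_def U_def)
    \<comment> \<open>The additive error becomes a multiplicative one through
      \<open>1 \<le> 2 * \<psi> x\<close>; this doubles the 4 to the 8 of the statement.\<close>
    also have "\<dots> \<le> \<psi> x + 4 * M * \<theta>\<^sup>2 * (K * (2 * \<psi> x))"
    proof -
      have "K * 1 \<le> K * (2 * \<psi> x)"
        using \<psi>_lower[OF x] K_gt_1 by (intro mult_left_mono) auto
      then show ?thesis
        using L1[OF x] M by (intro add_left_mono mult_left_mono) auto
    qed
    finally show ?thesis by (simp add: algebra_simps)
  qed
  then show ?thesis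
    using that[of \<psi>] \<psi>_lower \<psi>_upper unfolding F_def M_def power3_eq_cube by simp
qed

end

section \<open>Entropy of finite partitions\<close>

text \<open>\<open>partition_entropy_rate\<close> is defined through \<open>lim\<close>, so bounds
  on the finite stages say something about it only once convergence is known.\<close>

lemma fekete_nonneg:
  fixes u :: "nat \<Rightarrow> real"
  assumes nonneg: "\<And>n. 0 \<le> u n" and sub: "\<And>m n. u (m + n) \<le> u m + u n"
  shows "convergent (\<lambda>n. u n / real n)"
proof -
  define L where "L = (INF n\<in>{1..}. u n / real n)"
  have bdd: "bdd_below ((\<lambda>n. u n / real n) ` {1..})"
    using nonneg by (intro bdd_belowI[of _ 0]) auto
  have mult: "u (q * m + r) \<le> real q * u m + u r" for q m r
  proof (induction q)
    case (Suc q)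
    have "u (Suc q * m + r) \<le> u m + u (q * m + r)"
      using sub[of m "q * m + r"] by (simp add: add.assoc)
    also have "\<dots> \<le> real (Suc q) * u m + u r"
      using Suc by (simp add: algebra_simps)
    finally show ?case .
  qed simp
  have "(\<lambda>n. u n / real n) \<longlonglongrightarrow> L"
  proof (rule LIMSEQ_I)
    fix e :: real assume e: "0 < e"
    have "\<exists>m\<in>{1..}. u m / real m < L + e / 2"
      using cINF_less_iff[of "{1..}" "\<lambda>n. u n / real n" "L + e / 2"] bdd e
      by (auto simp: L_def)
    then obtain m where m: "1 \<le> m" "u m / real m < L + e / 2" by auto
    \<comment> \<open>A common bound for all remainders modulo \<open>m\<close>; it vanishes on
      division by \<open>n\<close>.\<close>
    define B where "B = (\<Sum>r<m. u r)"
    have B: "0 \<le> B" "\<And>r. r < m \<Longrightarrow> u r \<le> B"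
      using nonneg by (auto simp: B_def intro: sum_nonneg member_le_sum)
    obtain N :: nat where N: "2 * B / e < real N" using reals_Archimedean2 by blast
    have "norm (u n / real n - L) < e" if n: "n \<ge> max 1 N" for n
    proof -
      have n1: "1 \<le> n" "2 * B / e < real n" using n N by linarith+
      have low: "L \<le> u n / real n"
        unfolding L_def using n1 bdd by (intro cINF_lower) auto
      define q where "q = n div m"
      define r where "r = n mod m"
      have nq: "n = q * m + r" "r < m" using m by (auto simp: q_def r_def)
      have "u n \<le> real q * u m + B"
        using mult[of q m r] B(2)[of r] nq by simp
      also have "real q * u m = real (q * m) * (u m / real m)" using m by simp
      also have "\<dots> \<le> real n * (u m / real m)"
        using nq nonneg by (intro mult_right_mono) auto
      finally have "u n / real n \<le> u m / real m + B / real n"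
        using n1 by (simp add: field_simps)
      also have "B / real n < e / 2"
        using n1 e by (simp add: field_simps)
      finally show ?thesis using low m(2) by (simp add: abs_less_iff)
    qed
    then show "\<exists>no. \<forall>n\<ge>no. norm (u n / real n - L) < e" by blast
  qed
  then show ?thesis by (rule convergentI)
qed

section \<open>Finite partitions and Gibbs' inequality\<close>

lemma finite_measurable_partitionsD:
  assumes "P \<in> finite_measurable_partitions M"
  shows "finite P" "\<And>D. D \<in> P \<Longrightarrow> D \<in> sets M" "\<Union>P = space M" "disjoint P" "{} \<notin> P"
  using assms by (auto simp: finite_measurable_partitions_def partition_on_def)

lemma partition_cell:
  assumes "P \<in> finite_measurable_partitions M" "x \<in> space M"
  obtains D where "D \<in> P" "x \<in> D"
  using finite_measurable_partitionsD(3)[OF assms(1)] assms(2) by blast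

lemma sum_indicator_partition:
  fixes c :: "'a set \<Rightarrow> real"
  assumes P: "P \<in> finite_measurable_partitions M" and D: "D \<in> P" "x \<in> D"
  shows "(\<Sum>E\<in>P. c E * indicator E x) = c D"
proof -
  note [simp] = finite_measurable_partitionsD(1)[OF P]
  have "indicator E x = (if E = D then 1 else 0 :: real)" if "E \<in> P" for E
    using finite_measurable_partitionsD(4)[OF P] D that by (auto simp: disjoint_def indicator_def)
  then have "(\<Sum>E\<in>P. c E * indicator E x) = (\<Sum>E\<in>P. if E = D then c E else 0)"
    by (intro sum.cong) auto
  then show ?thesis using D by simp
qed

context prob_space
begin

lemma prob_partition:
  assumes P: "P \<in> finite_measurable_partitions M"
  shows "(\<Sum>D\<in>P. prob D) = 1"
proof -
  have "prob (\<Union>P) = (\<Sum>D\<in>P. prob D)"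
    using finite_measurable_partitionsD[OF P]
    by (intro measure_Union') (auto simp: disjoint_def pairwise_def disjnt_def fmeasurable_eq_sets)
  then show ?thesis using finite_measurable_partitionsD(3)[OF P] prob_space by simp
qed

lemma integral_partition:
  fixes f :: "'a \<Rightarrow> real"
  assumes P: "P \<in> finite_measurable_partitions M" and f: "integrable M f"
  shows "(\<integral>x. f x \<partial>M) = (\<Sum>D\<in>P. \<integral>x. indicator D x * f x \<partial>M)"
proof -
  have "(\<integral>x. f x \<partial>M) = (\<integral>x. (\<Sum>D\<in>P. indicator D x * f x) \<partial>M)"
  proof (intro Bochner_Integration.integral_cong refl)
    fix x assume "x \<in> space M"
    then obtain D where "D \<in> P" "x \<in> D" using partition_cell[OF P] by blast
    from sum_indicator_partition[OF P this, of "\<lambda>_. f x"]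
    show "f x = (\<Sum>D\<in>P. indicator D x * f x)" by (simp add: mult.commute)
  qed
  also have "\<dots> = (\<Sum>D\<in>P. \<integral>x. indicator D x * f x \<partial>M)"
    using finite_measurable_partitionsD[OF P] f
    by (intro Bochner_Integration.integral_sum) (auto intro: integrable_real_mult_indicator simp: mult.commute)
  finally show ?thesis .
qed

text \<open>The weights \<open>w D\<close> may overestimate \<open>g\<close>, so that \<open>g\<close> need not be constant on the cells.\<close>

lemma partition_entropy_le:
  assumes P: "P \<in> finite_measurable_partitions M"
    and int: "integrable M (\<lambda>x. ln (g x))" and pos: "AE x in M. 0 < g x"
    and le: "\<And>D x. D \<in> P \<Longrightarrow> x \<in> D \<Longrightarrow> g x \<le> w D"
    and w: "\<And>D. D \<in> P \<Longrightarrow> 0 \<le> w D" "sum w P \<le> Z" and Z: "0 < Z"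
  shows "partition_entropy M P \<le> ln Z - (\<integral>x. ln (g x) \<partial>M)"
proof -
  \<comment> \<open>Gibbs' inequality one cell at a time, from \<open>ln s \<le> s - 1\<close> at
    \<open>s = w D / (prob D * Z)\<close>. The right sides sum to at most 0.\<close>
  have cell: "(\<integral>x. indicator D x * ln (g x) \<partial>M) - prob D * ln (prob D) - prob D * ln Z \<le> w D / Z - prob D"
    if D: "D \<in> P" for D
  proof (cases "prob D = 0")
    case True
    then have "AE x in M. x \<notin> D"
      using D finite_measurable_partitionsD(2)[OF P] by (simp add: AE_iff_measurable[OF _ refl] prob_eq_0)
    then have "(\<integral>x. indicator D x * ln (g x) \<partial>M) = (\<integral>x. 0 \<partial>M)"
      by (intro integral_cong_AE) (auto intro!: borel_measurable_times borel_measurable_indicator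
          finite_measurable_partitionsD(2)[OF P] D borel_measurable_integrable[OF int])
    then show ?thesis using True w(1)[OF D] Z by simp
  next
    case False
    then have pD: "0 < prob D" by (simp add: zero_less_measure_iff)
    \<comment> \<open>Since \<open>w D\<close> dominates \<open>g\<close> on \<open>D\<close> and
      \<open>g\<close> is positive almost everywhere, a weight \<open>w D \<le> 0\<close> would
      force \<open>D\<close> to be null.\<close>
    have wD: "0 < w D"
    proof (rule ccontr)
      assume neg: "\<not> 0 < w D"
      have "AE x in M. x \<notin> D"
        using pos by eventually_elim (use le[OF D] neg in fastforce)
      then have "prob D = 0"
        using D finite_measurable_partitionsD(2)[OF P] by (simp add: AE_iff_measurable[OF _ refl] prob_eq_0)
      then show False using False by simp
    qed
    have "(\<integral>x. indicator D x * ln (g x) \<partial>M) \<le> (\<integral>x. indicator D x * ln (w D) \<partial>M)"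
    proof (rule integral_mono_AE)
      show "integrable M (\<lambda>x. indicator D x * ln (g x))"
        using integrable_real_mult_indicator[OF finite_measurable_partitionsD(2)[OF P D] int]
        by (simp add: mult.commute)
      show "integrable M (\<lambda>x. indicator D x * ln (w D))"
        using finite_measurable_partitionsD(2)[OF P D] by (simp add: integrable_indicator_iff less_top[symmetric])
      show "AE x in M. indicator D x * ln (g x) \<le> indicator D x * ln (w D)"
        using pos by eventually_elim (use le[OF D] wD in \<open>auto simp: indicator_def ln_le_cancel_iff\<close>)
    qed
    also have "\<dots> = prob D * ln (w D)"
      using finite_measurable_partitionsD(2)[OF P D] by simp
    finally have "(\<integral>x. indicator D x * ln (g x) \<partial>M) - prob D * ln (prob D) - prob D * ln Z
        \<le> prob D * (ln (w D) - ln (prob D) - ln Z)" by (simp add: algebra_simps)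
    also have "\<dots> = prob D * ln (w D / (prob D * Z))"
      using pD wD Z by (simp add: ln_div ln_mult)
    also have "\<dots> \<le> prob D * (w D / (prob D * Z) - 1)"
      using pD wD Z by (intro mult_left_mono ln_le_minus_one) auto
    also have "\<dots> = w D / Z - prob D" using pD by (simp add: field_simps)
    finally show ?thesis .
  qed
  have "(\<Sum>D\<in>P. (\<integral>x. indicator D x * ln (g x) \<partial>M) - prob D * ln (prob D) - prob D * ln Z)
      \<le> (\<Sum>D\<in>P. w D / Z - prob D)"
    using cell by (rule sum_mono)
  also have "\<dots> = sum w P / Z - 1"
    using prob_partition[OF P] by (simp add: sum_subtractf sum_divide_distrib)
  also have "\<dots> \<le> 0" using w(2) Z by simp
  finally show ?thesis
    unfolding partition_entropy_def integral_partition[OF P int]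
    using prob_partition[OF P] by (simp add: sum_subtractf flip: sum_distrib_right)
qed

lemma partition_entropy_nonneg: "0 \<le> partition_entropy M P"
proof -
  have "prob A * ln (prob A) \<le> 0" for A
    by (cases "prob A = 0") (auto intro!: mult_nonneg_nonpos simp: zero_less_measure_iff)
  then show ?thesis unfolding partition_entropy_def by (simp add: sum_nonpos)
qed

text \<open>The negative of \<open>ln (c x)\<close> is the information function. Writing the entropy
  as an integral makes invariance of the measure applicable to it.\<close>

lemma integral_ln_cell_prob:
  assumes P: "P \<in> finite_measurable_partitions M"
  defines "c \<equiv> \<lambda>x. \<Sum>D\<in>P. prob D * indicator D x"
  shows "integrable M (\<lambda>x. ln (c x))" "(\<integral>x. ln (c x) \<partial>M) = - partition_entropy M P"
    "AE x in M. 0 < c x"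
proof -
  have eq: "ln (c x) = (\<Sum>D\<in>P. ln (prob D) * indicator D x)" if x: "x \<in> space M" for x
  proof -
    obtain D where D: "D \<in> P" "x \<in> D" using partition_cell[OF P x] .
    show ?thesis unfolding c_def sum_indicator_partition[OF P D] ..
  qed
  have int: "integrable M (\<lambda>x. ln (prob D) * indicator D x :: real)" if "D \<in> P" for D
    using finite_measurable_partitionsD(2)[OF P that]
    by (simp add: integrable_indicator_iff less_top[symmetric])
  show "integrable M (\<lambda>x. ln (c x))"
    using int by (subst Bochner_Integration.integrable_cong[OF refl eq]) auto
  have "(\<integral>x. ln (c x) \<partial>M) = (\<integral>x. (\<Sum>D\<in>P. ln (prob D) * indicator D x) \<partial>M)"
    by (intro Bochner_Integration.integral_cong eq refl)
  also have "\<dots> = (\<Sum>D\<in>P. prob D * ln (prob D))"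
    using int finite_measurable_partitionsD(2)[OF P]
    by (subst Bochner_Integration.integral_sum) (auto intro!: sum.cong simp: mult.commute)
  finally show "(\<integral>x. ln (c x) \<partial>M) = - partition_entropy M P"
    by (simp add: partition_entropy_def)
  have "AE x in M. \<forall>D\<in>P. x \<in> D \<longrightarrow> prob D \<noteq> 0"
  proof (rule AE_finite_allI)
    fix D assume "D \<in> P"
    then show "AE x in M. x \<in> D \<longrightarrow> prob D \<noteq> 0"
      using finite_measurable_partitionsD(2)[OF P] 
      by (cases "prob D = 0") (auto simp: AE_iff_measurable[OF _ refl] prob_eq_0)
  qed (rule finite_measurable_partitionsD(1)[OF P])
  then show "AE x in M. 0 < c x"
  proof (rule AE_mp, intro AE_I2 impI)
    fix x assume x: "x \<in> space M" "\<forall>D\<in>P. x \<in> D \<longrightarrow> prob D \<noteq> 0"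
    obtain D where D: "D \<in> P" "x \<in> D" using partition_cell[OF P x(1)] .
    show "0 < c x"
      unfolding c_def sum_indicator_partition[OF P D] using x(2) D by (simp add: zero_less_measure_iff)
  qed
qed

end

lemma linear_over_n: "(\<lambda>n. (real n * a + b) / real n) \<longlonglongrightarrow> a"
proof -
  have "(\<lambda>n. a + b / real n) \<longlonglongrightarrow> a + 0"
    by (intro tendsto_intros lim_const_over_n)
  then show ?thesis
    by (rule Lim_transform_eventually[THEN tendsto_eq_rhs])
      (auto intro!: eventually_sequentiallyI[of 1] simp: field_simps)
qed

section \<open>Iterates of a measure preserving map and the entropy rate\<close>

locale measure_preserving_map = prob_space M for M :: "'a measure" +
  fixes f :: "'a \<Rightarrow> 'a"
  assumes measurable_f [measurable]: "f \<in> measurable M M" and distr_f: "distr M M f = M"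
begin

lemma measurable_funpow [measurable]: "f ^^ n \<in> measurable M M"
  by (induction n) (auto simp: id_def[symmetric] intro: measurable_comp)

lemma funpow_in_space: "x \<in> space M \<Longrightarrow> (f ^^ n) x \<in> space M"
  using measurable_space[OF measurable_funpow] .

lemma distr_funpow: "distr M M (f ^^ n) = M"
proof (induction n)
  case 0
  show ?case using distr_id[of M] by (simp add: id_def)
next
  case (Suc n)
  have "distr (distr M M (f ^^ n)) M f = distr M M (f \<circ> f ^^ n)"
    by (rule distr_distr) measurable
  then show ?case by (simp only: Suc distr_f funpow.simps)
qed

lemma integral_funpow:
  fixes \<phi> :: "'a \<Rightarrow> real"
  assumes "\<phi> \<in> borel_measurable M"
  shows "(\<integral>x. \<phi> ((f ^^ n) x) \<partial>M) = (\<integral>x. \<phi> x \<partial>M)"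
  using integral_distr[of "f ^^ n" M M \<phi>] assms distr_funpow[of n] by simp

lemma integrable_funpow:
  fixes \<phi> :: "'a \<Rightarrow> real"
  assumes "integrable M \<phi>"
  shows "integrable M (\<lambda>x. \<phi> ((f ^^ n) x))"
  using integrable_distr[of "f ^^ n" M M \<phi>] assms distr_funpow[of n] by simp

lemma AE_funpow:
  assumes "AE x in M. Q x"
  shows "AE x in M. Q ((f ^^ n) x)"
proof -
  have "AE x in distr M M (f ^^ n). Q x" by (subst distr_funpow) (rule assms)
  then show ?thesis by (rule AE_distrD[OF measurable_funpow])
qed

definition cylinder :: "nat \<Rightarrow> (nat \<Rightarrow> 'a set) \<Rightarrow> 'a set" where
  "cylinder n a = {x \<in> space M. \<forall>i<n. (f ^^ i) x \<in> a i}"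

lemma iterated_join_eq: "iterated_join M f P n = cylinder n ` ({..<n} \<rightarrow>\<^sub>E P) - {{}}"
  by (auto simp: iterated_join_def cylinder_def)

lemma iterated_join_partition:
  assumes P: "P \<in> finite_measurable_partitions M"
  shows "iterated_join M f P n \<in> finite_measurable_partitions M"
proof -
  have "finite (iterated_join M f P n)"
    using finite_measurable_partitionsD(1)[OF P] by (auto simp: iterated_join_eq intro!: finite_PiE)
  moreover have "cylinder n a \<in> sets M" if "a \<in> {..<n} \<rightarrow>\<^sub>E P" for a
  proof -
    have [measurable]: "a i \<in> sets M" if "i < n" for i
      using that \<open>a \<in> _\<close> finite_measurable_partitionsD(2)[OF P] by auto
    have "cylinder n a = {x \<in> space M. \<forall>i\<in>{..<n}. (f ^^ i) x \<in> a i}"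
      by (auto simp: cylinder_def)
    also have "\<dots> \<in> sets M" by measurable
    finally show ?thesis .
  qed
  moreover have "partition_on (space M) (iterated_join M f P n)"
  proof (rule partition_onI)
    show "\<Union>(iterated_join M f P n) = space M"
    proof (intro equalityI subsetI)
      fix x assume x: "x \<in> space M"
      have "\<forall>i. \<exists>D\<in>P. (f ^^ i) x \<in> D"
        using finite_measurable_partitionsD(3)[OF P] funpow_in_space[OF x] by blast
      then obtain a where a: "\<And>i. a i \<in> P \<and> (f ^^ i) x \<in> a i" by metis
      then have "restrict a {..<n} \<in> {..<n} \<rightarrow>\<^sub>E P" "x \<in> cylinder n (restrict a {..<n})"
        using x by (auto simp: cylinder_def)
      then show "x \<in> \<Union>(iterated_join M f P n)" by (auto simp: iterated_join_eq)
    qed (auto simp: iterated_join_def)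
  next
    fix C D assume C: "C \<in> iterated_join M f P n" "D \<in> iterated_join M f P n" "C \<noteq> D"
    then obtain a b where ab: "a \<in> {..<n} \<rightarrow>\<^sub>E P" "b \<in> {..<n} \<rightarrow>\<^sub>E P" "C = cylinder n a" "D = cylinder n b"
      by (auto simp: iterated_join_eq)
    show "disjnt C D"
    proof (rule ccontr)
      assume "\<not> disjnt C D"
      then obtain x where x: "x \<in> C" "x \<in> D" by (auto simp: disjnt_iff)
      have "a i = b i" if "i < n" for i
      proof -
        have "a i \<in> P" "b i \<in> P" "(f ^^ i) x \<in> a i \<inter> b i"
          using x ab that by (auto simp: cylinder_def)
        then show ?thesis using disjointD[OF finite_measurable_partitionsD(4)[OF P]] by blast
      qed
      then have "a = b" using ab by (intro PiE_ext) auto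
      then show False using C ab by simp
    qed
  qed (auto simp: iterated_join_eq)
  ultimately show ?thesis
    by (auto simp: finite_measurable_partitions_def iterated_join_eq)
qed

text \<open>An instance of Gibbs' inequality, without conditional entropy. The weight of a cell is
  the product of the probabilities of its first \<open>m\<close> and its last \<open>n\<close>
  letters; these weights have total at most 1, and by invariance the two logarithms integrate to
  \<open>- H m\<close> and \<open>- H n\<close>.\<close>

lemma partition_entropy_join_subadditive:
  assumes P: "P \<in> finite_measurable_partitions M"
  defines "H \<equiv> \<lambda>n. partition_entropy M (iterated_join M f P n)"
  shows "H (m + n) \<le> H m + H n"
proof -
  let ?J = "iterated_join M f P"
  define c where "c k x = (\<Sum>D\<in>?J k. prob D * indicator D x)" for k x
  note part = iterated_join_partition[OF P]
  note c = integral_ln_cell_prob[OF part, folded c_def]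
  define g where "g x = c m x * c n ((f ^^ m) x)" for x
  have c_nonneg: "0 \<le> c k x" for k x
    unfolding c_def by (intro sum_nonneg) auto
  have pos: "AE x in M. 0 < c m x \<and> 0 < c n ((f ^^ m) x)"
    using c(3)[of m] AE_funpow[OF c(3)[of n], of m] by eventually_elim simp
  have cm: "integrable M (\<lambda>x. ln (c m x))" "integrable M (\<lambda>x. ln (c n ((f ^^ m) x)))"
    using c(1) integrable_funpow[OF c(1)] by auto
  have c_meas [measurable]: "c k \<in> borel_measurable M" for k
    unfolding c_def using finite_measurable_partitionsD(2)[OF part] by (intro borel_measurable_sum) auto
  have AE_eq: "AE x in M. ln (g x) = ln (c m x) + ln (c n ((f ^^ m) x))"
    using pos by eventually_elim (simp add: g_def ln_mult)
  have g_meas: "(\<lambda>x. ln (g x)) \<in> borel_measurable M" unfolding g_def by measurable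
  \<comment> \<open>An itinerary is cut at time \<open>m\<close>: the first \<open>m\<close> letters
    give \<open>D\<close>, the others, shifted back, give \<open>E\<close>.\<close>
  have "\<exists>D E. D \<in> ?J m \<and> E \<in> ?J n \<and> C = D \<inter> {x \<in> space M. (f ^^ m) x \<in> E}" if C: "C \<in> ?J (m + n)" for C
  proof -
    obtain a where a: "a \<in> {..<m + n} \<rightarrow>\<^sub>E P" "C = cylinder (m + n) a" "C \<noteq> {}"
      using C unfolding iterated_join_eq by blast
    let ?b = "restrict a {..<m}" and ?c = "restrict (\<lambda>i. a (m + i)) {..<n}"
    have bc: "?b \<in> {..<m} \<rightarrow>\<^sub>E P" "?c \<in> {..<n} \<rightarrow>\<^sub>E P" using a by auto
    have "C = cylinder m ?b \<inter> {x \<in> space M. (f ^^ m) x \<in> cylinder n ?c}"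
    proof (intro equalityI subsetI)
      fix x assume "x \<in> C"
      then show "x \<in> cylinder m ?b \<inter> {x \<in> space M. (f ^^ m) x \<in> cylinder n ?c}"
        using funpow_in_space unfolding a(2) cylinder_def
        by (auto simp: funpow_add[symmetric, THEN fun_cong, simplified] add.commute)
    next
      fix x assume x: "x \<in> cylinder m ?b \<inter> {x \<in> space M. (f ^^ m) x \<in> cylinder n ?c}"
      have "(f ^^ i) x \<in> a i" if "i < m + n" for i
      proof (cases "i < m")
        case True then show ?thesis using x by (auto simp: cylinder_def)
      next
        case False
        then have "i - m < n" using that by simp
        then have "(f ^^ (i - m)) ((f ^^ m) x) \<in> a (m + (i - m))"
          using x by (auto simp: cylinder_def)
        moreover have "(f ^^ (i - m)) ((f ^^ m) x) = (f ^^ i) x"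
          using False funpow_add[of "i - m" m f] by simp
        ultimately show ?thesis using False by simp
      qed
      then show "x \<in> C" using x unfolding a(2) by (auto simp: cylinder_def)
    qed
    moreover from this have "cylinder m ?b \<noteq> {}" "cylinder n ?c \<noteq> {}" using a(3) by auto
    ultimately show ?thesis using bc
      by (intro exI[of _ "cylinder m ?b"] exI[of _ "cylinder n ?c"]) (auto simp: iterated_join_eq)
  qed
  then obtain d e where de: "\<And>C. C \<in> ?J (m + n) \<Longrightarrow> d C \<in> ?J m \<and> e C \<in> ?J n \<and>
      C = d C \<inter> {x \<in> space M. (f ^^ m) x \<in> e C}"
    by metis
  have "H (m + n) \<le> ln 1 - (\<integral>x. ln (g x) \<partial>M)"
    unfolding H_def
  proof (rule partition_entropy_le[OF part])
    show "integrable M (\<lambda>x. ln (g x))"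
      using AE_eq g_meas cm by (subst integrable_cong_AE[OF _ _ AE_eq]) auto
    show "AE x in M. 0 < g x"
      using pos by eventually_elim (simp add: g_def)
    show "g x \<le> prob (d C) * prob (e C)" if "C \<in> ?J (m + n)" "x \<in> C" for C x
    proof -
      have "x \<in> d C" "(f ^^ m) x \<in> e C" "d C \<in> ?J m" "e C \<in> ?J n" using de[OF that(1)] that(2) by blast+
      then show ?thesis
        unfolding g_def c_def by (simp add: sum_indicator_partition[OF part])
    qed
    \<comment> \<open>\<open>C\<close> is recovered from \<open>d C\<close> and \<open>e C\<close>
      as an intersection, so distinct cells use distinct pairs and the weights form a subsum of a
      product of two sums.\<close>
    have inj: "inj_on (\<lambda>C. (d C, e C)) (?J (m + n))"
      using de by (auto simp: inj_on_def) (metis de)+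
    have "(\<Sum>C\<in>?J (m + n). prob (d C) * prob (e C))
        = (\<Sum>(D, E)\<in>(\<lambda>C. (d C, e C)) ` ?J (m + n). prob D * prob E)"
      using sum.reindex[OF inj, of "\<lambda>(D, E). prob D * prob E"] by (simp add: comp_def)
    also have "\<dots> \<le> (\<Sum>(D, E)\<in>?J m \<times> ?J n. prob D * prob E)"
      using de finite_measurable_partitionsD(1)[OF part] by (intro sum_mono2) auto
    also have "\<dots> = 1"
      using prob_partition[OF part] by (simp add: sum.cartesian_product[symmetric] sum_product[symmetric])
    finally show "(\<Sum>C\<in>?J (m + n). prob (d C) * prob (e C)) \<le> 1" .
  qed auto
  also have "(\<integral>x. ln (g x) \<partial>M) = (\<integral>x. ln (c m x) + ln (c n ((f ^^ m) x)) \<partial>M)"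
    using AE_eq g_meas cm by (intro integral_cong_AE) auto
  also have "\<dots> = - H m - H n"
    using cm integral_funpow[of "\<lambda>x. ln (c n x)" m] by (simp add: c(2) H_def)
  finally show ?thesis by simp
qed

lemma entropy_rate_LIMSEQ:
  assumes P: "P \<in> finite_measurable_partitions M"
  shows "(\<lambda>n. partition_entropy M (iterated_join M f P n) / real n) \<longlonglongrightarrow> partition_entropy_rate M f P"
  unfolding partition_entropy_rate_def convergent_LIMSEQ_iff[symmetric]
  using partition_entropy_nonneg partition_entropy_join_subadditive[OF P] by (rule fekete_nonneg)

lemma entropy_rate_le:
  assumes P: "P \<in> finite_measurable_partitions M"
    and "\<And>n. partition_entropy M (iterated_join M f P n) \<le> real n * a + b"
  shows "partition_entropy_rate M f P \<le> a"
  using entropy_rate_LIMSEQ[OF P] linear_over_n[of a b]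
  by (rule LIMSEQ_le) (use assms(2) in \<open>auto intro!: divide_right_mono\<close>)

lemma entropy_rate_ge:
  assumes P: "P \<in> finite_measurable_partitions M"
    and "\<And>n. real n * a + b \<le> partition_entropy M (iterated_join M f P n)"
  shows "a \<le> partition_entropy_rate M f P"
  using linear_over_n[of a b] entropy_rate_LIMSEQ[OF P]
  by (rule LIMSEQ_le) (use assms(2) in \<open>auto intro!: divide_right_mono\<close>)

end

section \<open>The Parry measure\<close>

lemma space_unit_borel [simp]: "space unit_borel = {0..<1}"
  by (simp add: unit_borel_def space_restrict_space)

lemma sets_unit_borel_iff: "A \<in> sets unit_borel \<longleftrightarrow> A \<subseteq> {0..<1} \<and> A \<in> sets borel"
  by (auto simp: unit_borel_def sets_restrict_space_iff)

lemma measurable_unit_borelI: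
  assumes "sets M = sets unit_borel" "\<phi> \<in> borel_measurable borel"
  shows "\<phi> \<in> borel_measurable M"
  using measurable_cong_sets[OF assms(1) refl] assms(2)
  by (auto simp: unit_borel_def intro: measurable_restrict_space1)

context beta_transformation
begin

lemma parry_density_measurable [measurable]: "parry_density \<in> borel_measurable borel"
  unfolding parry_density_def orbit_sum_def[abs_def] by measurable

lemma parry_cdf_1_ge: "1 \<le> parry_cdf 1"
  using parry_cdf_bounds(1)[of 1] by simp

lemma T_measurable_unit_borel: "T \<in> measurable unit_borel unit_borel"
  unfolding unit_borel_def
  by (intro measurable_restrict_space3) auto

definition parry_measure :: "real measure" where
  "parry_measure =
     restrict_space (density lborel (\<lambda>x. ennreal (parry_density x / parry_cdf 1))) {0..<1}"

lemma sets_parry_measure [simp]: "sets parry_measure = sets unit_borel"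
  unfolding parry_measure_def unit_borel_def by (rule sets_restrict_space_cong) simp

lemma space_parry_measure [simp]: "space parry_measure = {0..<1}"
  using sets_eq_imp_space_eq[OF sets_parry_measure] by simp

lemma emeasure_parry_measure:
  assumes "A \<in> sets unit_borel"
  shows "emeasure parry_measure A
    = (\<integral>\<^sup>+x. ennreal (parry_density x / parry_cdf 1 * indicator A x) \<partial>lborel)"
proof -
  have A: "A \<subseteq> {0..<1}" and [measurable]: "A \<in> sets borel"
    using assms by (simp_all add: sets_unit_borel_iff)
  have "emeasure parry_measure A = emeasure (density lborel (\<lambda>x. ennreal (parry_density x / parry_cdf 1))) A"
    unfolding parry_measure_def using A by (intro emeasure_restrict_space) auto
  also have "\<dots> = (\<integral>\<^sup>+x. ennreal (parry_density x / parry_cdf 1) * indicator A x \<partial>lborel)"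
    by (rule emeasure_density) auto
  finally show ?thesis by (simp add: nn_integral_set_ennreal)
qed

text \<open>Bounds the Parry mass of a cylinder by its length, for the lower entropy bound.\<close>

lemma emeasure_parry_measure_le:
  assumes "A \<in> sets unit_borel"
  shows "emeasure parry_measure A \<le> ennreal K * emeasure lborel A"
proof -
  have [measurable]: "A \<in> sets borel" using assms by (simp add: sets_unit_borel_iff)
  have "parry_density x / parry_cdf 1 \<le> K" for x
  proof -
    have "parry_density x / parry_cdf 1 \<le> parry_density x / 1"
      using parry_cdf_1_ge parry_density_bounds[of x] by (intro divide_left_mono) auto
    then show ?thesis using parry_density_bounds[of x] by simp
  qed
  then have "(\<integral>\<^sup>+x. ennreal (parry_density x / parry_cdf 1 * indicator A x) \<partial>lborel)
      \<le> (\<integral>\<^sup>+x. ennreal K * indicator A x \<partial>lborel)"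
    by (intro nn_integral_mono) (auto simp: indicator_def ennreal_leI)
  then show ?thesis
    using emeasure_parry_measure[OF assms] by (simp add: nn_integral_cmult_indicator)
qed

text \<open>The density is a series of indicators of the intervals \<open>[0, (T ^^ n) 1)\<close>,
  and monotone convergence integrates it term by term.\<close>

lemma emeasure_parry_measure_less:
  assumes t: "0 \<le> t" "t \<le> 1"
  shows "emeasure parry_measure {0..<t} = ennreal (parry_cdf t / parry_cdf 1)"
proof -
  have T1: "0 \<le> (T ^^ m) 1" "(T ^^ m) 1 \<le> 1" for m
    using T_funpow_range[of 1 m] by auto
  let ?a = "\<lambda>n. (1 / \<beta>) ^ n / parry_cdf 1"
  have a: "0 \<le> ?a n" for n using parry_cdf_1_ge by simp
  have "ennreal (parry_density x / parry_cdf 1 * indicator {0..<t} x)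
      = (\<Sum>n. ennreal (?a n) * indicator {0..<min t ((T ^^ n) 1)} x)" for x
  proof -
    let ?b = "\<lambda>n. (1 / \<beta>) ^ n * (of_bool (x < (T ^^ n) 1) * indicator {0..<t} x) / parry_cdf 1"
    have s: "(\<lambda>n. (1 / \<beta>) ^ n * of_bool (x < (T ^^ n) 1)) sums parry_density x"
      unfolding parry_density_def orbit_sum_def by (intro summable_sums summable_series[of _ 1]) auto
    have "?b sums (parry_density x * indicator {0..<t} x / parry_cdf 1)"
      using sums_divide[OF sums_mult2[OF s]] by (simp add: mult.assoc)
    then have "(\<Sum>n. ennreal (?b n)) = ennreal (parry_density x / parry_cdf 1 * indicator {0..<t} x)"
      using parry_cdf_1_ge by (subst suminf_ennreal2) (auto simp: sums_iff)
    moreover have "ennreal (?b n) = ennreal (?a n) * indicator {0..<min t ((T ^^ n) 1)} x" for n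
      by (auto simp: indicator_def)
    ultimately show ?thesis by simp
  qed
  then have "emeasure parry_measure {0..<t}
      = (\<integral>\<^sup>+x. (\<Sum>n. ennreal (?a n) * indicator {0..<min t ((T ^^ n) 1)} x) \<partial>lborel)"
    using t by (simp add: emeasure_parry_measure sets_unit_borel_iff)
  also have "\<dots> = (\<Sum>n. \<integral>\<^sup>+x. ennreal (?a n) * indicator {0..<min t ((T ^^ n) 1)} x \<partial>lborel)"
    by (intro nn_integral_suminf) auto
  also have "\<dots> = (\<Sum>n. ennreal ((1 / \<beta>) ^ n * min t ((T ^^ n) 1) / parry_cdf 1))"
    using T1 t a by (intro suminf_cong) (simp add: nn_integral_cmult_indicator flip: ennreal_mult')
  also have "\<dots> = ennreal (\<Sum>n. (1 / \<beta>) ^ n * min t ((T ^^ n) 1) / parry_cdf 1)"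
    using T1 t parry_cdf_1_ge
    by (intro suminf_ennreal2 summable_divide summable_series[of _ 1]) (auto simp: min_def)
  also have "(\<Sum>n. (1 / \<beta>) ^ n * min t ((T ^^ n) 1) / parry_cdf 1) = parry_cdf t / parry_cdf 1"
    unfolding parry_cdf_def using T1 t by (intro suminf_divide summable_series[of _ 1]) auto
  finally show ?thesis .
qed

lemma prob_space_parry_measure: "prob_space parry_measure"
proof
  show "emeasure parry_measure (space parry_measure) = 1"
    using emeasure_parry_measure_less[of 1] parry_cdf_1_ge by simp
qed

text \<open>Duality between composition with \<open>T\<close> and the transfer operator. On the
  branch with digit \<open>j\<close> it is the affine substitution by
  \<open>(real j + x) / \<beta>\<close>, whose Jacobian is the \<open>1 / \<beta>\<close> in
  \<open>transfer\<close>.\<close>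

lemma nn_integral_transfer:
  assumes \<phi> [measurable]: "\<phi> \<in> borel_measurable borel" and nonneg: "\<And>x. 0 \<le> \<phi> x"
    and A: "A \<in> sets unit_borel"
  shows "(\<integral>\<^sup>+x. ennreal (indicator {0..<1} x * indicator A (T x) * \<phi> x) \<partial>lborel)
    = (\<integral>\<^sup>+x. ennreal (indicator A x * transfer \<phi> x) \<partial>lborel)"
proof -
  have A1: "A \<subseteq> {0..<1}" and [measurable]: "A \<in> sets borel"
    using A by (simp_all add: sets_unit_borel_iff)
  obtain N :: nat where N: "\<beta> \<le> real N" using real_arch_simple by blast
  \<comment> \<open>The part of the integrand with first digit \<open>j\<close>; digits below
    \<open>N\<close> suffice because \<open>\<beta> \<le> real N\<close>.\<close>
  define g where "g j x = indicator {0..<1} x * of_bool (\<lfloor>\<beta> * x\<rfloor> = int j) * indicator A (\<beta> * x - real j) * \<phi> x" for j x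
  have g_nonneg: "0 \<le> g j x" for j x unfolding g_def using nonneg by simp
  have [measurable]: "g j \<in> borel_measurable borel" for j
    unfolding g_def[abs_def] by measurable
  have split: "indicator {0..<1} x * indicator A (T x) * \<phi> x = (\<Sum>j<N. g j x)" for x
  proof (cases "x \<in> {0..<1}")
    case True
    define k where "k = nat \<lfloor>\<beta> * x\<rfloor>"
    have "\<beta> * x < \<beta> * 1" using True by (intro mult_strict_left_mono) auto
    moreover have k: "\<lfloor>\<beta> * x\<rfloor> = int k" using True by (simp add: k_def)
    ultimately have kN: "k < N" using N by linarith
    have Tx: "\<beta> * x - real k = T x" using beta_mult_eq[of x] k by linarith
    have "(\<Sum>j<N. g j x) = (\<Sum>j<N. if j = k then indicator A (T x) * \<phi> x else 0)"
      using True k Tx by (intro sum.cong) (auto simp: g_def)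
    then show ?thesis using True kN by simp
  qed (simp add: g_def)
  have branch: "(\<integral>\<^sup>+x. ennreal (g j x) \<partial>lborel)
      = (\<integral>\<^sup>+x. ennreal (indicator A x * (of_bool (real j + x < \<beta>) * \<phi> ((real j + x) / \<beta>)) / \<beta>) \<partial>lborel)" for j
  proof -
    have eq: "\<beta> * (real j / \<beta> + 1 / \<beta> * x) = real j + x" "real j / \<beta> + 1 / \<beta> * x = (real j + x) / \<beta>" for x
      by (simp_all add: field_simps)
    have "\<lfloor>real j + x\<rfloor> = int j" if "x \<in> A" for x
      using A1 that by (intro floor_unique) auto
    \<comment> \<open>For \<open>x\<close> in \<open>A\<close>, a subset of \<open>[0,1)\<close>,
      the digit condition is automatic, and the remaining condition
      \<open>(real j + x) / \<beta> < 1\<close> says that the branch \<open>j\<close> reaches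
      \<open>x\<close>.\<close>
    then have g: "g j (real j / \<beta> + 1 / \<beta> * x) = indicator A x * (of_bool (real j + x < \<beta>) * \<phi> ((real j + x) / \<beta>))" for x
      unfolding g_def eq using A1 by (auto simp: indicator_def)
    have "(\<integral>\<^sup>+x. ennreal (g j x) \<partial>lborel) = ennreal \<bar>1 / \<beta>\<bar> * (\<integral>\<^sup>+x. ennreal (g j (real j / \<beta> + 1 / \<beta> * x)) \<partial>lborel)"
      by (rule nn_integral_real_affine) auto
    also have "\<dots> = (\<integral>\<^sup>+x. ennreal (1 / \<beta>) * ennreal (g j (real j / \<beta> + 1 / \<beta> * x)) \<partial>lborel)"
      by (subst nn_integral_cmult) (auto simp: abs_of_pos)
    also have "\<dots> = (\<integral>\<^sup>+x. ennreal (1 / \<beta> * g j (real j / \<beta> + 1 / \<beta> * x)) \<partial>lborel)"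
      using g_nonneg by (intro nn_integral_cong ennreal_mult[symmetric]) auto
    finally show ?thesis unfolding g by simp
  qed
  have tr: "(\<Sum>j<N. indicator A x * (of_bool (real j + x < \<beta>) * \<phi> ((real j + x) / \<beta>)) / \<beta>)
      = indicator A x * transfer \<phi> x" for x
  proof (cases "x \<in> A")
    case True
    then have x: "0 \<le> x" "x < 1" using A1 by auto
    have "(\<Sum>y\<in>preimages x. \<phi> y) = (\<Sum>j\<in>{j. real j + x < \<beta>}. \<phi> ((real j + x) / \<beta>))"
      unfolding preimages_eq[OF x] by (subst sum.reindex[OF inj_branch]) simp
    also have "\<dots> = (\<Sum>j<N. of_bool (real j + x < \<beta>) * \<phi> ((real j + x) / \<beta>))"
    proof (rule sum.mono_neutral_cong_left)
      show "{j. real j + x < \<beta>} \<subseteq> {..<N}"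
      proof
        fix j assume "j \<in> {j. real j + x < \<beta>}"
        then have "real j < real N" using x N by simp
        then show "j \<in> {..<N}" by simp
      qed
    qed auto
    finally show ?thesis
      by (simp only: transfer_def sum_distrib_left sum_divide_distrib times_divide_eq_right)
  qed simp
  have "(\<integral>\<^sup>+x. ennreal (indicator {0..<1} x * indicator A (T x) * \<phi> x) \<partial>lborel)
      = (\<integral>\<^sup>+x. (\<Sum>j<N. ennreal (g j x)) \<partial>lborel)"
    unfolding split using g_nonneg by (simp add: sum_ennreal)
  also have "\<dots> = (\<Sum>j<N. \<integral>\<^sup>+x. ennreal (g j x) \<partial>lborel)"
    by (rule nn_integral_sum) auto
  also have "\<dots> = (\<integral>\<^sup>+x. (\<Sum>j<N. ennreal (indicator A x * (of_bool (real j + x < \<beta>) * \<phi> ((real j + x) / \<beta>)) / \<beta>)) \<partial>lborel)"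
    unfolding branch by (rule nn_integral_sum[symmetric]) auto
  also have "\<dots> = (\<integral>\<^sup>+x. ennreal (indicator A x * transfer \<phi> x) \<partial>lborel)"
    using nonneg by (intro nn_integral_cong) (subst sum_ennreal, auto simp: tr)
  finally show ?thesis .
qed

lemma parry_measure_invariant: "parry_measure \<in> invariant_measures unit_borel T"
proof -
  have meas: "T \<in> measurable parry_measure parry_measure"
    using T_measurable_unit_borel measurable_cong_sets[OF sets_parry_measure sets_parry_measure] by auto
  have "distr parry_measure parry_measure T = parry_measure"
  proof (rule measure_eqI)
    fix A assume "A \<in> sets (distr parry_measure parry_measure T)"
    then have A: "A \<in> sets unit_borel" by simp
    let ?d = "\<lambda>x. parry_density x / parry_cdf 1"
    have pre: "T -` A \<inter> space parry_measure \<in> sets unit_borel"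
      using measurable_sets[OF meas, of A] A by simp
    have "emeasure (distr parry_measure parry_measure T) A = emeasure parry_measure (T -` A \<inter> space parry_measure)"
      using meas A by (intro emeasure_distr) auto
    also have "\<dots> = (\<integral>\<^sup>+x. ennreal (indicator {0..<1} x * indicator A (T x) * ?d x) \<partial>lborel)"
      unfolding emeasure_parry_measure[OF pre]
      by (intro nn_integral_cong arg_cong[where f = ennreal]) (auto simp: indicator_def)
    also have "\<dots> = (\<integral>\<^sup>+x. ennreal (indicator A x * transfer ?d x) \<partial>lborel)"
      using parry_density_bounds parry_cdf_1_ge A by (intro nn_integral_transfer) auto
    also have "\<dots> = (\<integral>\<^sup>+x. ennreal (?d x * indicator A x) \<partial>lborel)"
    proof (intro nn_integral_cong arg_cong[where f = ennreal])
      fix x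
      have "transfer ?d x = ?d x" if "x \<in> A"
        using transfer_cmult[of "1 / parry_cdf 1" parry_density x] transfer_parry_density[of x] that A
        by (auto simp: sets_unit_borel_iff)
      then show "indicator A x * transfer ?d x = ?d x * indicator A x"
        by (auto simp: indicator_def)
    qed
    finally show "emeasure (distr parry_measure parry_measure T) A = emeasure parry_measure A"
      using emeasure_parry_measure[OF A] by simp
  qed simp
  then show ?thesis
    using meas prob_space_parry_measure by (simp add: invariant_measures_def)
qed

lemma measure_preserving_map_invariant:
  "\<mu> \<in> invariant_measures unit_borel T \<Longrightarrow> measure_preserving_map \<mu> T"
  by (intro measure_preserving_map.intro measure_preserving_map_axioms.intro)
    (simp_all add: invariant_measures_def)

text \<open>For integral \<open>\<beta>\<close> the digit \<open>\<lfloor>\<beta>\<rfloor>\<close>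
  does not occur; removing the empty set discards its cell.\<close>

definition digit_partition :: "real set set" where
  "digit_partition = (\<lambda>j. {x \<in> {0..<1}. \<lfloor>\<beta> * x\<rfloor> = j}) ` {0..\<lfloor>\<beta>\<rfloor>} - {{}}"

lemma digit_partition_measurable:
  assumes M: "sets M = sets unit_borel"
  shows "digit_partition \<in> finite_measurable_partitions M"
proof -
  have sp: "space M = {0..<1}" using sets_eq_imp_space_eq[OF M] by simp
  have "{x \<in> {0..<1}. \<lfloor>\<beta> * x\<rfloor> = j} \<in> sets borel" for j
    by measurable
  then have "digit_partition \<subseteq> sets M"
    unfolding M by (auto simp: digit_partition_def sets_unit_borel_iff)
  moreover have "partition_on {0..<1} digit_partition"
  proof (rule partition_onI)
    show "\<Union>digit_partition = {0..<1}"
    proof (intro equalityI subsetI)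
      fix x :: real assume x: "x \<in> {0..<1}"
      have "\<beta> * x \<le> \<beta> * 1" using x by (intro mult_left_mono) auto
      then have "\<lfloor>\<beta> * x\<rfloor> \<in> {0..\<lfloor>\<beta>\<rfloor>}" using x by (auto intro: floor_mono)
      then have "{y \<in> {0..<1}. \<lfloor>\<beta> * y\<rfloor> = \<lfloor>\<beta> * x\<rfloor>} \<in> digit_partition"
        using x unfolding digit_partition_def by blast
      then show "x \<in> \<Union>digit_partition" using x by blast
    qed (auto simp: digit_partition_def)
  qed (auto simp: digit_partition_def disjnt_iff)
  moreover have "finite digit_partition" by (simp add: digit_partition_def)
  ultimately show ?thesis by (simp add: finite_measurable_partitions_def sp)
qed

lemma left_end_eqI:
  assumes "\<And>i. i < n \<Longrightarrow> \<lfloor>\<beta> * (T ^^ i) x\<rfloor> = \<lfloor>\<beta> * (T ^^ i) y\<rfloor>"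
  shows "left_end n x = left_end n y"
  using assms
proof (induction n arbitrary: x y)
  case (Suc n)
  have "left_end n (T x) = left_end n (T y)"
    using Suc.prems[of "Suc i" for i] by (intro Suc.IH) (simp add: T_funpow_Suc del: funpow.simps)
  then show ?case using Suc.prems[of 0] by simp
qed simp

text \<open>Each cell of the \<open>n\<close>-fold join lies in an interval of length
  \<open>(1 / \<beta>) ^ n\<close>, so its mass is at most \<open>K * (1 / \<beta>) ^ n\<close> and
  its information at least \<open>real n * ln \<beta> - ln K\<close>. The \<open>ln K\<close> is
  invisible in the rate.\<close>

lemma parry_entropy_ge: "ereal (ln \<beta>) \<le> ks_entropy T parry_measure"
proof -
  interpret measure_preserving_map parry_measure T
    by (rule measure_preserving_map_invariant[OF parry_measure_invariant])
  note part = digit_partition_measurable[OF sets_parry_measure]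
  note J = iterated_join_partition[OF part]
  have "ln \<beta> \<le> partition_entropy_rate parry_measure T digit_partition"
  proof (rule entropy_rate_ge[OF part])
    fix n
    have cell: "prob D * (real n * ln \<beta> - ln K) \<le> - (prob D * ln (prob D))"
      if D: "D \<in> iterated_join parry_measure T digit_partition n" for D
    proof (cases "prob D = 0")
      case False
      then have pos: "0 < prob D" by (simp add: zero_less_measure_iff)
      obtain a where a: "a \<in> {..<n} \<rightarrow>\<^sub>E digit_partition" "D = cylinder n a" "D \<noteq> {}"
        using D unfolding iterated_join_eq by blast
      then obtain x where x: "x \<in> D" by auto
      \<comment> \<open>Points of one cell share their first \<open>n\<close> digits and hence their
        left endpoint.\<close>
      have "D \<subseteq> {left_end n x..left_end n x + (1 / \<beta>) ^ n}"
      proof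
        fix y assume y: "y \<in> D"
        have "left_end n y = left_end n x"
        proof (rule left_end_eqI)
          fix i assume "i < n"
          then have "a i \<in> digit_partition" "(T ^^ i) x \<in> a i" "(T ^^ i) y \<in> a i"
            using a x y by (auto simp: cylinder_def)
          moreover from this(1) obtain j where "a i = {x \<in> {0..<1}. \<lfloor>\<beta> * x\<rfloor> = j}"
            unfolding digit_partition_def by blast
          ultimately show "\<lfloor>\<beta> * (T ^^ i) y\<rfloor> = \<lfloor>\<beta> * (T ^^ i) x\<rfloor>"
            by simp
        qed
        moreover have "y \<in> {0..<1}" using y a by (auto simp: cylinder_def)
        ultimately show "y \<in> {left_end n x..left_end n x + (1 / \<beta>) ^ n}"
          using left_end_bounds[of y n] by simp
      qed
      then have "emeasure lborel D \<le> emeasure lborel {left_end n x..left_end n x + (1 / \<beta>) ^ n}"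
        by (intro emeasure_mono) auto
      then have "emeasure parry_measure D \<le> ennreal K * ennreal ((1 / \<beta>) ^ n)"
        using emeasure_parry_measure_le[of D] finite_measurable_partitionsD(2)[OF J D]
        by (auto intro: order_trans[OF _ mult_left_mono])
      then have "prob D \<le> K * (1 / \<beta>) ^ n"
        using K_gt_1 by (simp add: emeasure_eq_measure flip: ennreal_mult)
      then have "ln (prob D) \<le> ln (K * (1 / \<beta>) ^ n)"
        using pos by simp
      also have "\<dots> = ln K - real n * ln \<beta>"
        using K_gt_1 by (simp add: ln_mult ln_realpow ln_div)
      finally have "prob D * ln (prob D) \<le> prob D * (ln K - real n * ln \<beta>)"
        using pos by (intro mult_left_mono) auto
      then show ?thesis by (simp add: algebra_simps)
    qed simp
    have "(\<Sum>D\<in>iterated_join parry_measure T digit_partition n. prob D * (real n * ln \<beta> - ln K))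
        \<le> (\<Sum>D\<in>iterated_join parry_measure T digit_partition n. - (prob D * ln (prob D)))"
      by (intro sum_mono cell)
    then show "real n * ln \<beta> + (- ln K)
        \<le> partition_entropy parry_measure (iterated_join parry_measure T digit_partition n)"
      using prob_partition[OF J] by (simp add: partition_entropy_def sum_negf flip: sum_distrib_right)
  qed
  then show ?thesis
    unfolding ks_entropy_def using part by (intro SUP_upper2[of digit_partition]) auto
qed

end

section \<open>Entropy controls the discrepancy\<close>

context beta_transformation
begin

section \<open>A fixed invariant measure: Borel sets approximated by unions of cylinders\<close>

context
  fixes \<mu> :: "real measure"
  assumes inv: "\<mu> \<in> invariant_measures unit_borel T"
begin

interpretation measure_preserving_map \<mu> T
  by (rule measure_preserving_map_invariant[OF inv])

lemma sets_mu: "sets \<mu> = sets unit_borel"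
  using inv by (simp add: invariant_measures_def)

lemma space_mu: "space \<mu> = {0..<1}"
  using sets_eq_imp_space_eq[OF sets_mu] by simp

lemma Collect_in_sets:
  assumes "{x. Q x} \<in> sets borel"
  shows "{x \<in> {0..<1}. Q x} \<in> sets \<mu>"
proof -
  have "{x \<in> {0..<1}. Q x} = {0..<1} \<inter> {x. Q x}" by auto
  then show ?thesis using assms by (simp add: sets_mu sets_unit_borel_iff)
qed

lemma measurable_muI: "\<phi> \<in> borel_measurable borel \<Longrightarrow> \<phi> \<in> borel_measurable \<mu>"
  using measurable_unit_borelI[OF sets_mu] .

text \<open>The points where guessing membership in \<open>A\<close> from the first \<open>k\<close>
  digits fails. A union of cylinders is encoded as the preimage of a Borel set \<open>Y\<close>
  under \<open>left_end k\<close>, so that measurability needs no enumeration of cylinders.\<close>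

definition error_set :: "real set \<Rightarrow> nat \<Rightarrow> real set \<Rightarrow> real set" where
  "error_set A k Y = {x \<in> {0..<1}. (x \<in> A) \<noteq> (left_end k x \<in> Y)}"

lemma error_set_measurable:
  assumes "A \<in> sets borel" "Y \<in> sets borel"
  shows "error_set A k Y \<in> sets \<mu>"
proof -
  note [measurable] = assms
  have "{x. (x \<in> A) \<noteq> (left_end k x \<in> Y)} \<in> sets borel" by measurable
  then show ?thesis unfolding error_set_def by (rule Collect_in_sets)
qed

lemma left_end_vimage_borel:
  assumes [measurable]: "Y \<in> sets borel"
  shows "{y. left_end k y \<in> Y} \<in> sets borel"
  by measurable

text \<open>The guess fails only where the endpoint is at most \<open>a\<close> and the point lies
  beyond \<open>a\<close>, hence within \<open>(1 / \<beta>) ^ k\<close> of \<open>a\<close>. These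
  intervals shrink to the empty set.\<close>

lemma approximate_atMost:
  assumes "0 < e"
  shows "\<exists>k. prob (error_set {..a} k {..a}) < e"
proof -
  define F where "F k = {x \<in> {0..<1}. a < x \<and> x < a + (1 / \<beta>) ^ k}" for k :: nat
  have F_sets: "F k \<in> sets \<mu>" for k
    unfolding F_def by (rule Collect_in_sets) measurable
  have lim: "(\<lambda>k. (1 / \<beta>) ^ k) \<longlonglongrightarrow> 0" by (rule LIMSEQ_power_zero) simp
  have "(1 / \<beta>) ^ Suc k \<le> (1 / \<beta>) ^ k" for k
    by (intro power_decreasing) (auto simp: less_imp_le)
  then have "F (Suc k) \<subseteq> F k" for k unfolding F_def by (fastforce intro: less_le_trans)
  then have "decseq F" by (simp add: decseq_Suc_iff)
  moreover have "range F \<subseteq> sets \<mu>" using F_sets by auto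
  ultimately have "(\<lambda>k. prob (F k)) \<longlonglongrightarrow> prob (\<Inter>k. F k)"
    by (intro finite_Lim_measure_decseq)
  moreover have "(\<Inter>k. F k) = {}"
  proof (rule ccontr)
    assume "(\<Inter>k. F k) \<noteq> {}"
    then obtain x where x: "\<And>k. x \<in> F k" by blast
    have "x \<le> a"
      using x by (intro LIMSEQ_le_const[OF tendsto_add[OF tendsto_const lim, of a, simplified]])
        (auto simp: F_def intro: less_imp_le)
    then show False using x[of 0] by (simp add: F_def)
  qed
  ultimately have "(\<lambda>k. prob (F k)) \<longlonglongrightarrow> 0" by simp
  then have "\<forall>\<^sub>F k in sequentially. prob (F k) < e" using assms by (rule order_tendstoD)
  then obtain k where "prob (F k) < e" using eventually_happens by force
  moreover have "error_set {..a} k {..a} \<subseteq> F k"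
    using left_end_bounds[of _ k] by (force simp: error_set_def F_def)
  ultimately show ?thesis using finite_measure_mono[OF _ F_sets] by (meson le_less_trans)
qed

text \<open>The sets that can be approximated form a sigma-algebra, and it contains the generating
  rays.\<close>

lemma approximate_borel:
  assumes "A \<in> sets borel" "0 < e"
  shows "\<exists>k. \<exists>Y\<in>sets borel. prob (error_set A k Y) < e"
proof -
  have "A \<in> sigma_sets UNIV (range atMost)"
    using assms(1) unfolding borel_eq_atMost by (simp add: atMost_def[abs_def])
  then have "A \<in> sets borel \<and> (\<forall>e>0. \<exists>k. \<exists>Y\<in>sets borel. prob (error_set A k Y) < e)"
  proof (induction rule: sigma_sets.induct)
    case (Basic B)
    then obtain a where "B = {..a}" by blast
    moreover have "{..a} \<in> sets borel" by simp
    ultimately show ?case using approximate_atMost[of _ a] by blast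
  next
    case Empty
    have "error_set {} 0 {} = {}" by (simp add: error_set_def)
    then show ?case by (auto intro!: exI[of _ 0] bexI[of _ "{}"])
  next
    case (Compl B)
    have "error_set (UNIV - B) k (UNIV - Y) = error_set B k Y" for k Y
      by (auto simp: error_set_def)
    then show ?case using Compl.IH
      by (metis borel_comp Compl_eq_Diff_UNIV)
  next
    case (Union A)
    then have A: "\<And>i. A i \<in> sets borel" by blast
    have "\<exists>k. \<exists>Y\<in>sets borel. prob (error_set (\<Union>i. A i) k Y) < e" if e: "0 < e" for e
    proof -
      \<comment> \<open>What the first \<open>n\<close> sets leave out of the union. It decreases to
        the empty set, so a finite union is good enough up to \<open>e / 2\<close>.\<close>
      define R where "R n = {x \<in> {0..<1}. x \<in> (\<Union>i. A i) \<and> x \<notin> (\<Union>i<n. A i)}" for n :: nat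
      note [measurable] = A
      have R_sets: "R n \<in> sets \<mu>" for n
        unfolding R_def by (intro Collect_in_sets) measurable
      have "decseq R" unfolding decseq_Suc_iff R_def by (fastforce simp: less_Suc_eq)
      then have "(\<lambda>n. prob (R n)) \<longlonglongrightarrow> prob (\<Inter>n. R n)"
        using R_sets by (intro finite_Lim_measure_decseq) auto
      moreover have "(\<Inter>n. R n) = {}" unfolding R_def by fastforce
      ultimately have "(\<lambda>n. prob (R n)) \<longlonglongrightarrow> 0" by simp
      then have "\<forall>\<^sub>F n in sequentially. prob (R n) < e / 2" using e by (intro order_tendstoD) auto
      then obtain n where n: "prob (R n) < e / 2" using eventually_happens by force
      \<comment> \<open>The \<open>n\<close> errors then add up to at most \<open>e / 2\<close>; the
        added 1 covers \<open>n = 0\<close>.\<close>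
      have "\<forall>i. \<exists>k Y. Y \<in> sets borel \<and> prob (error_set (A i) k Y) < e / (2 * (real n + 1))"
        using Union.IH e by (metis divide_pos_pos mult_pos_pos zero_less_numeral of_nat_0_le_iff
            add_nonneg_pos zero_less_one)
      then obtain k Y where kY: "\<And>i. Y i \<in> sets borel"
          "\<And>i. prob (error_set (A i) (k i) (Y i)) < e / (2 * (real n + 1))"
        by metis
      \<comment> \<open>A rank no smaller than any of the \<open>k i\<close>: coarser endpoints are
        functions of finer ones by \<open>left_end_left_end\<close>, so all \<open>n\<close> guesses
        can be made from a single endpoint.\<close>
      define k' where "k' = (\<Sum>i<n. k i)"
      define Y' where "Y' = (\<Union>i<n. {y. left_end (k i) y \<in> Y i})"
      have Y': "Y' \<in> sets borel" unfolding Y'_def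
        using kY(1) left_end_vimage_borel by (intro sets.finite_UN) auto
      have sub: "error_set (\<Union>i. A i) k' Y' \<subseteq> R n \<union> (\<Union>i<n. error_set (A i) (k i) (Y i))"
      proof
        fix x assume x: "x \<in> error_set (\<Union>i. A i) k' Y'"
        then have x1: "x \<in> {0..<1}" by (simp add: error_set_def)
        have le: "left_end (k i) (left_end k' x) = left_end (k i) x" if "i < n" for i
          using x1 that unfolding k'_def by (intro left_end_left_end member_le_sum) auto
        then show "x \<in> R n \<union> (\<Union>i<n. error_set (A i) (k i) (Y i))"
          using x by (auto simp: error_set_def R_def Y'_def)
      qed
      have "prob (error_set (\<Union>i. A i) k' Y') \<le> prob (R n \<union> (\<Union>i<n. error_set (A i) (k i) (Y i)))"
        using sub R_sets error_set_measurable A kY(1) by (intro finite_measure_mono sets.Un sets.finite_UN) auto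
      also have "\<dots> \<le> prob (R n) + prob (\<Union>i<n. error_set (A i) (k i) (Y i))"
        using R_sets error_set_measurable A kY(1) by (intro measure_Un_le sets.finite_UN) auto
      also have "prob (\<Union>i<n. error_set (A i) (k i) (Y i)) \<le> (\<Sum>i<n. prob (error_set (A i) (k i) (Y i)))"
        using error_set_measurable A kY(1) by (intro finite_measure_subadditive_finite) auto
      also have "\<dots> \<le> (\<Sum>i<n. e / (2 * (real n + 1)))"
        using kY(2) by (intro sum_mono less_imp_le) auto
      also have "\<dots> \<le> e / 2" using e by (simp add: field_simps)
      finally show ?thesis using n Y' by (auto intro!: exI[of _ k'] bexI[of _ Y'])
    qed
    then show ?case using A by auto
  qed
  then show ?thesis using assms(2) by blast
qed

text \<open>The digits of a point predict its cell in \<open>Q\<close> up to an arbitrarily small mean logarithmic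
  loss; this replaces the conditional entropy estimate of the Kolmogorov--Sinai generator theorem.\<close>

lemma predicting_kernel:
  assumes Q: "Q \<in> finite_measurable_partitions \<mu>" and e: "0 < e"
  obtains k \<kappa> where "m \<le> k" "\<And>a y. a \<in> Q \<Longrightarrow> 0 < \<kappa> a y" "\<And>y. (\<Sum>a\<in>Q. \<kappa> a y) \<le> (1::real)"
    "integrable \<mu> (\<lambda>x. \<Sum>a\<in>Q. ln (\<kappa> a (left_end k x)) * indicator a x)"
    "- e \<le> (\<integral>x. (\<Sum>a\<in>Q. ln (\<kappa> a (left_end k x)) * indicator a x) \<partial>\<mu>)"
proof -
  note QD = finite_measurable_partitionsD[OF Q]
  have Q_borel: "a \<in> sets borel" if "a \<in> Q" for a
    using QD(2)[OF that] by (simp add: sets_mu sets_unit_borel_iff)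
  have "Q \<noteq> {}" using QD(3) space_mu by auto
  then have q: "1 \<le> real (card Q)" using QD(1) by (simp add: Suc_leI card_gt_0_iff)
  define q where "q = real (card Q)"
  \<comment> \<open>The vote of a cell that the digits reject. On good points the normalisation
    costs at most \<open>q * \<delta> \<le> e / 2\<close>.\<close>
  define \<delta> where "\<delta> = min 1 (e / (2 * q))"
  have \<delta>: "0 < \<delta>" "\<delta> \<le> 1" "q * \<delta> \<le> e / 2"
    using e q by (auto simp: \<delta>_def q_def min_def field_simps)
  \<comment> \<open>The largest possible loss: no prediction falls below
    \<open>\<delta> / q\<close>.\<close>
  define \<Lambda> where "\<Lambda> = ln (q / \<delta>)"
  have \<Lambda>: "0 \<le> \<Lambda>" using \<delta> q by (simp add: \<Lambda>_def q_def)
  \<comment> \<open>Chosen so that the loss \<open>\<Lambda>\<close> on a bad set of measure at most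
    \<open>q * \<eta>\<close> integrates to at most \<open>e / 2\<close>. The added 1 keeps the
    denominator nonzero when \<open>\<Lambda> = 0\<close>.\<close>
  define \<eta> where "\<eta> = e / (2 * q * (\<Lambda> + 1))"
  have \<eta>: "0 < \<eta>" using e q \<Lambda> by (simp add: \<eta>_def q_def)
  have "\<forall>a. \<exists>k Y. a \<in> Q \<longrightarrow> Y \<in> sets borel \<and> prob (error_set a k Y) < \<eta>"
    using approximate_borel[OF Q_borel \<eta>] by blast
  then obtain ka Y where kY: "\<And>a. a \<in> Q \<Longrightarrow> Y a \<in> sets borel"
      "\<And>a. a \<in> Q \<Longrightarrow> prob (error_set a (ka a) (Y a)) < \<eta>"
    by metis
  define k where "k = m + sum ka Q"
  have ka_le: "ka a \<le> k" if "a \<in> Q" for a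
    using member_le_sum[of a Q ka] QD(1) that by (simp add: k_def)
  \<comment> \<open>Each cell votes 1 or \<open>\<delta>\<close> by its own guess. Normalising the
    votes gives positive probabilities even where the guesses contradict each other.\<close>
  define v where "v a y = (if left_end (ka a) y \<in> Y a then 1 else \<delta>)" for a y
  have v: "\<delta> \<le> v a y" "v a y \<le> 1" "0 < v a y" for a y
    using \<delta> by (auto simp: v_def)
  define s where "s y = (\<Sum>a\<in>Q. v a y)" for y
  have s: "0 < s y" "s y \<le> q" for y
  proof -
    show "0 < s y" unfolding s_def using v \<open>Q \<noteq> {}\<close> QD(1) by (intro sum_pos) auto
    have "s y \<le> (\<Sum>a\<in>Q. 1)" unfolding s_def using v by (intro sum_mono) auto
    then show "s y \<le> q" by (simp add: q_def)
  qed
  define \<kappa> where "\<kappa> a y = v a y / s y" for a y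
  have \<kappa>_pos: "0 < \<kappa> a y" for a y using v s by (simp add: \<kappa>_def)
  have \<kappa>_sum: "(\<Sum>a\<in>Q. \<kappa> a y) = 1" for y
    using s[of y] by (simp add: \<kappa>_def s_def flip: sum_divide_distrib)
  have \<kappa>_lower: "- \<Lambda> \<le> ln (\<kappa> a y)" for a y
  proof -
    have "\<delta> / q \<le> \<kappa> a y"
      unfolding \<kappa>_def using v s \<delta> by (intro frac_le) (auto intro: less_imp_le)
    moreover have "0 < \<delta> / q" using \<delta> q by (simp add: q_def)
    ultimately have "ln (\<delta> / q) \<le> ln (\<kappa> a y)" by (rule ln_mono)
    then show ?thesis using \<delta> q by (simp add: \<Lambda>_def q_def ln_div)
  qed
  have \<kappa>_upper: "ln (\<kappa> a y) \<le> 0" if "a \<in> Q" for a y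
  proof -
    have "\<kappa> a y \<le> (\<Sum>a\<in>Q. \<kappa> a y)"
      using that QD(1) \<kappa>_pos by (intro member_le_sum) (auto intro: less_imp_le)
    then show ?thesis using \<kappa>_sum \<kappa>_pos by simp
  qed
  define L where "L x = (\<Sum>a\<in>Q. ln (\<kappa> a (left_end k x)) * indicator a x)" for x
  define bad where "bad = (\<Union>a\<in>Q. error_set a (ka a) (Y a))"
  have bad_sets: "bad \<in> sets \<mu>"
    unfolding bad_def using QD(1) Q_borel kY(1) error_set_measurable by (intro sets.finite_UN) auto
  have L_meas: "L \<in> borel_measurable \<mu>"
  proof -
    have v_meas: "v a \<in> borel_measurable borel" if "a \<in> Q" for a
    proof -
      note [measurable] = kY(1)[OF that]
      show ?thesis unfolding v_def[abs_def] by measurable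
    qed
    then have "s \<in> borel_measurable borel" unfolding s_def[abs_def] by (intro borel_measurable_sum) auto
    then have \<kappa>_meas: "\<kappa> a \<in> borel_measurable borel" if "a \<in> Q" for a
      unfolding \<kappa>_def[abs_def] using v_meas[OF that] by measurable
    have "(\<lambda>x. ln (\<kappa> a (left_end k x)) * indicator a x) \<in> borel_measurable borel" if "a \<in> Q" for a
    proof -
      note [measurable] = Q_borel[OF that] \<kappa>_meas[OF that]
      show ?thesis by measurable
    qed
    then have "L \<in> borel_measurable borel" unfolding L_def[abs_def] by (intro borel_measurable_sum) auto
    then show ?thesis by (rule measurable_muI)
  qed
  have L_bounds: "- \<Lambda> \<le> L x" "L x \<le> 0" "x \<notin> bad \<Longrightarrow> - (q * \<delta>) \<le> L x" if x: "x \<in> space \<mu>" for x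
  proof -
    obtain a where a: "a \<in> Q" "x \<in> a" using partition_cell[OF Q x] .
    have L: "L x = ln (\<kappa> a (left_end k x))"
      unfolding L_def by (rule sum_indicator_partition[OF Q a])
    show "- \<Lambda> \<le> L x" "L x \<le> 0" unfolding L using \<kappa>_lower \<kappa>_upper a by auto
    assume nb: "x \<notin> bad"
    \<comment> \<open>Outside \<open>bad\<close> every guess is right, so exactly the cell
      containing \<open>x\<close> votes 1 and the votes add up to at most
      \<open>1 + q * \<delta>\<close>.\<close>
    have in_Y: "left_end (ka b) (left_end k x) \<in> Y b \<longleftrightarrow> x \<in> b" if "b \<in> Q" for b
      using nb that x left_end_left_end[OF _ ka_le[OF that], of x]
      by (auto simp: bad_def error_set_def space_mu)
    have va: "v a (left_end k x) = 1" using in_Y[OF a(1)] a by (simp add: v_def)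
    have "v b (left_end k x) = \<delta>" if "b \<in> Q - {a}" for b
      using in_Y[of b] that a QD(4) by (auto simp: v_def disjoint_def)
    then have "s (left_end k x) = 1 + real (card Q - 1) * \<delta>"
      unfolding s_def using QD(1) a va by (subst sum.remove[of _ a]) auto
    also have "\<dots> \<le> 1 + q * \<delta>"
      unfolding q_def using \<delta> by (intro add_left_mono mult_right_mono) auto
    finally have "ln (s (left_end k x)) \<le> q * \<delta>"
      using s[of "left_end k x"] ln_le_minus_one[of "s (left_end k x)"] by linarith
    then show "- (q * \<delta>) \<le> L x"
      unfolding L \<kappa>_def va using s[of "left_end k x"] by (simp add: ln_div)
  qed
  have L_int: "integrable \<mu> L"
  proof (rule integrable_const_bound[of _ \<Lambda>, OF AE_I2])
    show "norm (L x) \<le> \<Lambda>" if "x \<in> space \<mu>" for x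
      using L_bounds(1,2)[OF that] \<Lambda> by simp
  qed (rule L_meas)
  have ind_int: "integrable \<mu> (\<lambda>x. indicator bad x :: real)"
    using bad_sets by (simp add: integrable_indicator_iff less_top[symmetric])
  have "prob bad \<le> (\<Sum>a\<in>Q. prob (error_set a (ka a) (Y a)))"
    unfolding bad_def using QD(1) Q_borel kY(1) error_set_measurable
    by (intro finite_measure_subadditive_finite) auto
  also have "\<dots> \<le> (\<Sum>a\<in>Q. \<eta>)" using kY(2) by (intro sum_mono less_imp_le) auto
  finally have "prob bad \<le> q * \<eta>" by (simp add: q_def)
  then have "\<Lambda> * prob bad \<le> (\<Lambda> + 1) * (q * \<eta>)"
    using \<Lambda> \<eta> q by (intro mult_mono) (auto simp: q_def)
  also have "\<dots> = e / 2"
  proof -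
    have "2 * q * (\<Lambda> + 1) \<noteq> 0" using \<Lambda> q by (simp add: q_def)
    then show ?thesis unfolding \<eta>_def by (simp add: field_simps)
  qed
  finally have "- e \<le> - (q * \<delta>) - \<Lambda> * prob bad" using \<delta>(3) by linarith
  also have "\<dots> = (\<integral>x. - (q * \<delta>) - \<Lambda> * indicator bad x \<partial>\<mu>)"
    using ind_int bad_sets prob_space by simp
  also have "\<dots> \<le> (\<integral>x. L x \<partial>\<mu>)"
  proof (rule integral_mono)
    show "integrable \<mu> (\<lambda>x. - (q * \<delta>) - \<Lambda> * indicator bad x)" using ind_int by auto
    fix x assume "x \<in> space \<mu>"
    then show "- (q * \<delta>) - \<Lambda> * indicator bad x \<le> L x"
      using L_bounds[of x] \<delta> q by (cases "x \<in> bad") (auto simp: q_def intro: order_trans[rotated])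
  qed (rule L_int)
  finally have L_lower: "- e \<le> (\<integral>x. L x \<partial>\<mu>)" .
  show thesis
    using that[of k \<kappa>] \<kappa>_pos \<kappa>_sum L_int L_lower unfolding L_def by (simp add: k_def)
qed

section \<open>The entropy inequality for the tilted potential\<close>

lemma integrable_centred_indicator: "integrable \<mu> (centred_indicator t)"
  "(\<integral>x. centred_indicator t x \<partial>\<mu>) = prob {0..<t} - parry_cdf t / parry_cdf 1"
  if t: "0 \<le> t" "t \<le> 1"
proof -
  have sets: "{0..<t} \<in> sets \<mu>" using t by (auto simp: sets_mu sets_unit_borel_iff)
  then have int: "integrable \<mu> (\<lambda>x. indicator {0..<t} x :: real)"
    by (simp add: integrable_indicator_iff less_top[symmetric])
  have eq: "centred_indicator t x = indicator {0..<t} x - parry_cdf t / parry_cdf 1" if "x \<in> space \<mu>" for x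
    using that by (auto simp: centred_indicator_def space_mu indicator_def)
  show "integrable \<mu> (centred_indicator t)"
    using int by (subst Bochner_Integration.integrable_cong[OF refl eq]) auto
  show "(\<integral>x. centred_indicator t x \<partial>\<mu>) = prob {0..<t} - parry_cdf t / parry_cdf 1"
    using int sets prob_space by (subst Bochner_Integration.integral_cong[OF refl eq]) auto
qed

lemma centred_indicator_left_end:
  assumes "t \<in> {0..<1}" "(T ^^ m) t = 0" "m \<le> n" "x \<in> {0..<1}"
  shows "centred_indicator t (left_end n x) = centred_indicator t x"
  using less_iff_left_end_less[OF assms] by (simp add: centred_indicator_def)

text \<open>Gibbs' inequality for the words of length \<open>N\<close> over \<open>Q\<close>. The
  weight of a word combines the tilted weight of digit cylinders with the probability that the
  digits predict the word. Summed over all words the predictions drop out and the partition function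
  remains, while along a typical orbit they cost only \<open>e\<close> per step.\<close>

lemma entropy_rate_le_tilted:
  assumes t: "t \<in> {0..<1}" "(T ^^ m) t = 0" and th: "\<bar>\<theta>\<bar> \<le> 1 / (4 * (K * K))"
    and Q: "Q \<in> finite_measurable_partitions \<mu>" and e: "0 < e"
  shows "partition_entropy_rate \<mu> T Q
    \<le> ln \<beta> + 8 * K ^ 3 * \<theta>\<^sup>2 - \<theta> * (\<integral>x. centred_indicator t x \<partial>\<mu>) + e"
proof -
  let ?F = "centred_indicator t"
  have t01: "0 \<le> t" "t \<le> 1" using t by auto
  define \<rho> where "\<rho> = 1 + 8 * K ^ 3 * \<theta>\<^sup>2"
  have K3: "0 < K ^ 3" using K_gt_1 by simp
  have \<rho>: "1 \<le> \<rho>" using K3 by (simp add: \<rho>_def)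
  obtain \<psi> where \<psi>: "\<And>y. y \<in> {0..<1} \<Longrightarrow> 1 / 2 \<le> \<psi> y" "\<psi> 0 \<le> 3 * (K * K)"
      "\<And>y. y \<in> {0..<1} \<Longrightarrow> transfer (\<lambda>y. exp (\<theta> * ?F y) * \<psi> y) y \<le> \<rho> * \<psi> y"
    using tilted_subinvariant[OF t01 th] unfolding \<rho>_def by blast
  obtain k \<kappa> where k: "m \<le> k" and \<kappa>: "\<And>a y. a \<in> Q \<Longrightarrow> 0 < \<kappa> a y" "\<And>y. (\<Sum>a\<in>Q. \<kappa> a y) \<le> (1::real)"
    and L_int: "integrable \<mu> (\<lambda>x. \<Sum>a\<in>Q. ln (\<kappa> a (left_end k x)) * indicator a x)"
    and L_lower: "- e \<le> (\<integral>x. (\<Sum>a\<in>Q. ln (\<kappa> a (left_end k x)) * indicator a x) \<partial>\<mu>)"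
    by (rule predicting_kernel[OF Q e, of m], rule that)
  define L where "L x = (\<Sum>a\<in>Q. ln (\<kappa> a (left_end k x)) * indicator a x)" for x
  note QD = finite_measurable_partitionsD[OF Q]
  \<comment> \<open>The loss in comparing a point with its cylinder: \<open>k\<close> surplus terms
    of the orbit sum, each at least \<open>- \<bar>\<theta>\<bar>\<close>, and the factor
    \<open>\<psi> \<ge> 1 / 2\<close>.\<close>
  define c where "c = real k * \<bar>\<theta>\<bar> + ln 2"
  define b where "b = real k * (ln \<beta> + ln \<rho>) + ln (3 * (K * K)) + c"
  have F_int: "integrable \<mu> ?F" by (rule integrable_centred_indicator[OF t01])
  have bound: "partition_entropy \<mu> (iterated_join \<mu> T Q N)
      \<le> real N * (ln \<beta> + ln \<rho> - \<theta> * (\<integral>x. ?F x \<partial>\<mu>) - (\<integral>x. L x \<partial>\<mu>)) + b" for N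
  proof -
    \<comment> \<open>With \<open>k\<close> digits in reserve, at each time \<open>i < N\<close> the
      remaining rank \<open>n - i\<close> is at least \<open>k\<close>, enough for the prediction
      and, as \<open>m \<le> k\<close>, for evaluating the indicator.\<close>
    define n where "n = N + k"
    define \<Phi> where "\<Phi> x = (\<Sum>i<N. \<theta> * ?F ((T ^^ i) x) + L ((T ^^ i) x)) - c" for x
    define W where "W a = (\<Sum>y\<in>preimages_pow n 0. exp (\<Sum>i<n. \<theta> * ?F ((T ^^ i) y)) * \<psi> y
        * (\<Prod>i<N. \<kappa> (a i) (left_end k ((T ^^ i) y))))" for a
    have preim: "y \<in> {0..<1}" if "y \<in> preimages_pow n 0" for y
      using that by (simp add: preimages_pow_def)
    have \<psi>_pos: "0 < \<psi> y" if "y \<in> preimages_pow n 0" for y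
      using \<psi>(1)[OF preim[OF that]] by linarith
    have \<kappa>_word: "0 \<le> \<kappa> (a i) z" if "a \<in> {..<N} \<rightarrow>\<^sub>E Q" "i < N" for a i z
    proof -
      have "a i \<in> Q" using that by auto
      then show ?thesis using \<kappa>(1) by (intro less_imp_le)
    qed
    have W_nonneg: "0 \<le> W a" if "a \<in> {..<N} \<rightarrow>\<^sub>E Q" for a
      unfolding W_def using \<psi>_pos \<kappa>_word[OF that]
      by (intro sum_nonneg mult_nonneg_nonneg prod_nonneg) (auto intro: less_imp_le)
    have W_sum: "(\<Sum>a\<in>{..<N} \<rightarrow>\<^sub>E Q. W a) \<le> (\<beta> * \<rho>) ^ n * (3 * (K * K))"
    proof -
      have "(\<Sum>a\<in>{..<N} \<rightarrow>\<^sub>E Q. W a) = (\<Sum>y\<in>preimages_pow n 0. exp (\<Sum>i<n. \<theta> * ?F ((T ^^ i) y)) * \<psi> y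
          * (\<Sum>a\<in>{..<N} \<rightarrow>\<^sub>E Q. \<Prod>i<N. \<kappa> (a i) (left_end k ((T ^^ i) y))))"
        unfolding W_def by (subst sum.swap) (simp add: sum_distrib_left)
      \<comment> \<open>The sum over words of a product over times is a product of sums over
        \<open>Q\<close>, each at most 1.\<close>
      also have "\<dots> = (\<Sum>y\<in>preimages_pow n 0. exp (\<Sum>i<n. \<theta> * ?F ((T ^^ i) y)) * \<psi> y
          * (\<Prod>i<N. \<Sum>a\<in>Q. \<kappa> a (left_end k ((T ^^ i) y))))"
        using QD(1) by (subst prod_sum_PiE) auto
      also have "\<dots> \<le> (\<Sum>y\<in>preimages_pow n 0. exp (\<Sum>i<n. \<theta> * ?F ((T ^^ i) y)) * \<psi> y * 1)"
        using \<psi>_pos \<kappa> by (intro sum_mono mult_left_mono prod_le_1) (auto intro!: sum_nonneg intro: less_imp_le)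
      also have "\<dots> \<le> (\<beta> * \<rho>) ^ n * \<psi> 0"
        using partition_function_le[of "\<lambda>y. \<theta> * ?F y" \<psi> \<rho> 0 n] \<psi>(3) \<rho> by simp
      also have "\<dots> \<le> (\<beta> * \<rho>) ^ n * (3 * (K * K))"
        using \<psi>(2) \<rho> by (intro mult_left_mono) auto
      finally show ?thesis .
    qed
    \<comment> \<open>The zero \<open>left_end n x\<close> supplies one summand of
      \<open>W a\<close>; at all times below \<open>N\<close> it has the same tilt and the same
      predictions as \<open>x\<close>, and the other summands are nonnegative.\<close>
    have \<Phi>_le: "exp (\<Phi> x) \<le> W a" if a: "a \<in> {..<N} \<rightarrow>\<^sub>E Q" and x: "x \<in> cylinder N a" for a x
    proof -
      define y where "y = left_end n x"
      have x1: "x \<in> {0..<1}" and xa: "\<And>i. i < N \<Longrightarrow> (T ^^ i) x \<in> a i" using x by (auto simp: cylinder_def space_mu)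
      have y: "y \<in> preimages_pow n 0" unfolding y_def by (rule left_end_preimages[OF x1])
      have orb: "(T ^^ i) y = left_end (n - i) ((T ^^ i) x)" if "i < N" for i
        unfolding y_def using x1 that by (intro T_funpow_left_end) (auto simp: n_def)
      have F_eq: "?F ((T ^^ i) y) = ?F ((T ^^ i) x)" if "i < N" for i
        unfolding orb[OF that] using t T_funpow_in[OF x1] that k
        by (intro centred_indicator_left_end[of t m]) (auto simp: n_def)
      have \<kappa>_eq: "\<kappa> (a i) (left_end k ((T ^^ i) y)) = exp (L ((T ^^ i) x))" if i: "i < N" for i
      proof -
        have ai: "a i \<in> Q" using a i by auto
        have "left_end k ((T ^^ i) y) = left_end k ((T ^^ i) x)"
          unfolding orb[OF i] using T_funpow_in[OF x1] i by (intro left_end_left_end) (auto simp: n_def)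
        moreover have "L ((T ^^ i) x) = ln (\<kappa> (a i) (left_end k ((T ^^ i) x)))"
          unfolding L_def by (rule sum_indicator_partition[OF Q ai xa[OF i]])
        ultimately show ?thesis using \<kappa>(1)[OF ai] by simp
      qed
      have "(\<Sum>i<n. \<theta> * ?F ((T ^^ i) y)) = (\<Sum>i<N. \<theta> * ?F ((T ^^ i) y)) + (\<Sum>i=N..<n. \<theta> * ?F ((T ^^ i) y))"
        using sum.atLeastLessThan_concat[of 0 N n "\<lambda>i. \<theta> * ?F ((T ^^ i) y)"]
        by (simp add: n_def lessThan_atLeast0)
      moreover have "- (real k * \<bar>\<theta>\<bar>) \<le> (\<Sum>i=N..<n. \<theta> * ?F ((T ^^ i) y))"
      proof -
        have "- \<bar>\<theta>\<bar> \<le> \<theta> * ?F z" for z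
        proof -
          have "\<bar>\<theta> * ?F z\<bar> \<le> \<bar>\<theta>\<bar> * 1"
            unfolding abs_mult using abs_centred_indicator[OF t01] by (intro mult_left_mono) auto
          then show ?thesis by linarith
        qed
        then have "(\<Sum>i=N..<n. - \<bar>\<theta>\<bar>) \<le> (\<Sum>i=N..<n. \<theta> * ?F ((T ^^ i) y))" by (intro sum_mono)
        then show ?thesis by (simp add: n_def)
      qed
      ultimately have S: "(\<Sum>i<N. \<theta> * ?F ((T ^^ i) x)) - real k * \<bar>\<theta>\<bar> \<le> (\<Sum>i<n. \<theta> * ?F ((T ^^ i) y))"
        using F_eq by simp
      have "exp (\<Phi> x) = exp ((\<Sum>i<N. \<theta> * ?F ((T ^^ i) x)) - real k * \<bar>\<theta>\<bar>) * (1 / 2) * exp (\<Sum>i<N. L ((T ^^ i) x))"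
        by (simp add: \<Phi>_def c_def sum.distrib exp_add exp_diff field_simps)
      also have "\<dots> \<le> exp (\<Sum>i<n. \<theta> * ?F ((T ^^ i) y)) * \<psi> y * exp (\<Sum>i<N. L ((T ^^ i) x))"
        using S \<psi>(1)[OF preim[OF y]] by (intro mult_right_mono mult_mono) auto
      also have "exp (\<Sum>i<N. L ((T ^^ i) x)) = (\<Prod>i<N. \<kappa> (a i) (left_end k ((T ^^ i) y)))"
        by (simp add: exp_sum \<kappa>_eq)
      also have "exp (\<Sum>i<n. \<theta> * ?F ((T ^^ i) y)) * \<psi> y * (\<Prod>i<N. \<kappa> (a i) (left_end k ((T ^^ i) y))) \<le> W a"
        unfolding W_def
      proof (rule member_le_sum[OF y _ finite_preimages_pow])
        fix z assume "z \<in> preimages_pow n 0 - {y}"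
        then show "0 \<le> exp (\<Sum>i<n. \<theta> * ?F ((T ^^ i) z)) * \<psi> z * (\<Prod>i<N. \<kappa> (a i) (left_end k ((T ^^ i) z)))"
          using \<psi>_pos[of z] \<kappa>_word[OF a] by (intro mult_nonneg_nonneg prod_nonneg) (auto intro: less_imp_le)
      qed
      finally show ?thesis .
    qed
    note J = iterated_join_partition[OF Q, of N]
    have "\<forall>D\<in>iterated_join \<mu> T Q N. \<exists>a. a \<in> {..<N} \<rightarrow>\<^sub>E Q \<and> D = cylinder N a"
      unfolding iterated_join_eq by blast
    then obtain word where word: "\<And>D. D \<in> iterated_join \<mu> T Q N \<Longrightarrow> word D \<in> {..<N} \<rightarrow>\<^sub>E Q \<and> D = cylinder N (word D)"
      by metis
    have L_int': "integrable \<mu> L" using L_int by (simp add: L_def[abs_def])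
    have term_int: "integrable \<mu> (\<lambda>x. \<theta> * ?F ((T ^^ i) x) + L ((T ^^ i) x))" for i
      using integrable_funpow[OF F_int, of i] integrable_funpow[OF L_int', of i] by simp
    have sum_int: "integrable \<mu> (\<lambda>x. \<Sum>i<N. \<theta> * ?F ((T ^^ i) x) + L ((T ^^ i) x))"
      by (rule Bochner_Integration.integrable_sum) (rule term_int)
    then have \<Phi>_int: "integrable \<mu> \<Phi>"
      unfolding \<Phi>_def[abs_def] by (rule Bochner_Integration.integrable_diff) simp
    have \<Phi>_integral: "(\<integral>x. \<Phi> x \<partial>\<mu>) = real N * (\<theta> * (\<integral>x. ?F x \<partial>\<mu>) + (\<integral>x. L x \<partial>\<mu>)) - c"
    proof -
      have "(\<integral>x. \<theta> * ?F ((T ^^ i) x) + L ((T ^^ i) x) \<partial>\<mu>) = \<theta> * (\<integral>x. ?F x \<partial>\<mu>) + (\<integral>x. L x \<partial>\<mu>)" for i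
        using integral_funpow[OF borel_measurable_integrable[OF F_int], of i]
          integral_funpow[OF borel_measurable_integrable[OF L_int'], of i]
          integrable_funpow[OF F_int, of i] integrable_funpow[OF L_int', of i] by simp
      then have "(\<integral>x. (\<Sum>i<N. \<theta> * ?F ((T ^^ i) x) + L ((T ^^ i) x)) \<partial>\<mu>) = real N * (\<theta> * (\<integral>x. ?F x \<partial>\<mu>) + (\<integral>x. L x \<partial>\<mu>))"
        using Bochner_Integration.integral_sum[of "{..<N}" \<mu>, OF term_int] by simp
      then show ?thesis
        unfolding \<Phi>_def using prob_space Bochner_Integration.integral_diff[OF sum_int, of "\<lambda>_. c"] by simp
    qed
    have "partition_entropy \<mu> (iterated_join \<mu> T Q N)
        \<le> ln ((\<beta> * \<rho>) ^ n * (3 * (K * K))) - (\<integral>x. ln (exp (\<Phi> x)) \<partial>\<mu>)"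
    proof (rule partition_entropy_le[OF J])
      show "exp (\<Phi> x) \<le> W (word D)" if "D \<in> iterated_join \<mu> T Q N" "x \<in> D" for D x
        using \<Phi>_le word[OF that(1)] that(2) by blast
      show "0 \<le> W (word D)" if "D \<in> iterated_join \<mu> T Q N" for D
        using W_nonneg word[OF that] by blast
      have "inj_on word (iterated_join \<mu> T Q N)" using word by (metis inj_onI)
      then have "(\<Sum>D\<in>iterated_join \<mu> T Q N. W (word D)) = sum W (word ` iterated_join \<mu> T Q N)"
        by (simp add: sum.reindex)
      also have "\<dots> \<le> (\<Sum>a\<in>{..<N} \<rightarrow>\<^sub>E Q. W a)"
        using word W_nonneg QD(1) by (intro sum_mono2 finite_PiE) auto
      finally show "(\<Sum>D\<in>iterated_join \<mu> T Q N. W (word D)) \<le> (\<beta> * \<rho>) ^ n * (3 * (K * K))"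
        using W_sum by linarith
      show "0 < (\<beta> * \<rho>) ^ n * (3 * (K * K))" using \<rho> K_gt_1 by simp
    qed (use \<Phi>_int in auto)
    also have "ln ((\<beta> * \<rho>) ^ n * (3 * (K * K))) = real n * (ln \<beta> + ln \<rho>) + ln (3 * (K * K))"
      using \<rho> K_gt_1 by (simp add: ln_mult ln_realpow)
    finally show ?thesis
      unfolding b_def by (simp add: \<Phi>_integral n_def algebra_simps)
  qed
  have "partition_entropy_rate \<mu> T Q \<le> ln \<beta> + ln \<rho> - \<theta> * (\<integral>x. ?F x \<partial>\<mu>) - (\<integral>x. L x \<partial>\<mu>)"
    by (rule entropy_rate_le[OF Q bound])
  moreover have "ln \<rho> \<le> 8 * K ^ 3 * \<theta>\<^sup>2"
  proof -
    have "ln \<rho> \<le> \<rho> - 1" using \<rho> by (intro ln_le_minus_one) simp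
    then show ?thesis by (simp add: \<rho>_def)
  qed
  ultimately show ?thesis using L_lower by (simp add: L_def[abs_def])
qed

text \<open>For zeros of an iterate of \<open>T\<close> this is
  \<open>entropy_rate_le_tilted\<close> with the best \<open>\<theta>\<close>. For other
  \<open>t < 1\<close> the left endpoints of the cylinders around \<open>t\<close> increase to
  \<open>t\<close>, and both measures of \<open>[0,s)\<close> are left-continuous in
  \<open>s\<close>.\<close>

lemma entropy_discrepancy:
  assumes t: "0 \<le> t" "t \<le> 1"
  shows "ks_entropy T \<mu> \<le> ereal (ln \<beta> - (prob {0..<t} - measure parry_measure {0..<t})\<^sup>2 / (32 * K ^ 3))"
proof -
  define d where "d s = prob {0..<s} - measure parry_measure {0..<s}" for s
  have parry: "measure parry_measure {0..<s} = parry_cdf s / parry_cdf 1" if "0 \<le> s" "s \<le> 1" for s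
    using emeasure_parry_measure_less[OF that] parry_cdf_bounds(1)[OF that] parry_cdf_1_ge that
    by (simp add: measure_def)
  have K3: "1 \<le> K" "0 < K ^ 3" "K * K \<le> K ^ 3"
    using K_gt_1 by (simp_all add: power3_eq_cube)
  have zero: "partition_entropy_rate \<mu> T Q \<le> ln \<beta> - (d s)\<^sup>2 / (32 * K ^ 3)"
    if s: "s \<in> {0..<1}" "(T ^^ m) s = 0" and Q: "Q \<in> finite_measurable_partitions \<mu>" for s m Q
  proof (rule field_le_epsilon)
    fix e :: real assume e: "0 < e"
    \<comment> \<open>The minimiser of \<open>8 * K ^ 3 * \<theta>\<^sup>2 - \<theta> * d s\<close>.
      It lies in the admissible range because \<open>\<bar>d s\<bar> \<le> 1\<close> and
      \<open>4 * (K * K) \<le> 16 * K ^ 3\<close>.\<close>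
    define \<theta> where "\<theta> = d s / (16 * K ^ 3)"
    have s01: "0 \<le> s" "s \<le> 1" using s by auto
    have F: "(\<integral>x. centred_indicator s x \<partial>\<mu>) = d s"
      using integrable_centred_indicator(2)[OF s01] parry[OF s01] by (simp add: d_def)
    have "\<bar>d s\<bar> \<le> 1"
      unfolding d_def using prob_le_1[of "{0..<s}"] prob_space.prob_le_1[OF prob_space_parry_measure, of "{0..<s}"]
      by (smt (verit) measure_nonneg)
    then have "\<bar>\<theta>\<bar> \<le> 1 / (16 * K ^ 3)"
      using K3 by (simp add: \<theta>_def abs_divide divide_right_mono)
    also have "\<dots> \<le> 1 / (4 * (K * K))"
    proof -
      have "4 * (K * K) \<le> 16 * K ^ 3" using K3 by linarith
      then show ?thesis using K_gt_1 by (intro divide_left_mono) auto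
    qed
    finally have "partition_entropy_rate \<mu> T Q \<le> ln \<beta> + 8 * K ^ 3 * \<theta>\<^sup>2 - \<theta> * d s + e"
      using entropy_rate_le_tilted[OF s _ Q e] F by simp
    moreover have "8 * K ^ 3 * \<theta>\<^sup>2 - \<theta> * d s = - ((d s)\<^sup>2 / (32 * K ^ 3))"
      using K3 by (simp add: \<theta>_def field_simps power2_eq_square)
    ultimately show "partition_entropy_rate \<mu> T Q \<le> ln \<beta> - (d s)\<^sup>2 / (32 * K ^ 3) + e" by linarith
  qed
  have "partition_entropy_rate \<mu> T Q \<le> ln \<beta> - (d t)\<^sup>2 / (32 * K ^ 3)"
    if Q: "Q \<in> finite_measurable_partitions \<mu>" for Q
  proof (cases "t = 1")
    case True
    \<comment> \<open>The point 1 is outside the domain of the left endpoints, but both measures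
      give \<open>[0,1)\<close> mass 1, so \<open>d 1 = d 0\<close> and the zero
      \<open>s = 0\<close> serves.\<close>
    have "d 1 = 0"
      using prob_space space_mu prob_space.prob_space[OF prob_space_parry_measure] by (simp add: d_def)
    then show ?thesis using zero[of 0 0 Q] Q True by (simp add: d_def)
  next
    case False
    then have t1: "t \<in> {0..<1}" using t by auto
    have "left_end n t \<le> left_end (Suc n) t" for n
      using left_end_bounds(2)[OF left_end_in[OF t1, of "Suc n"], of n] left_end_left_end[OF t1, of n "Suc n"] by simp
    then have inc: "incseq (\<lambda>n. {0..<left_end n t})"
      unfolding incseq_Suc_iff by (auto intro: less_le_trans)
    have lim0: "(\<lambda>n. (1 / \<beta>) ^ n) \<longlonglongrightarrow> 0" by (rule LIMSEQ_power_zero) simp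
    have un: "(\<Union>n. {0..<left_end n t}) = {0..<t}"
    proof (intro equalityI subsetI)
      fix x assume "x \<in> (\<Union>n. {0..<left_end n t})"
      then show "x \<in> {0..<t}" using left_end_bounds(2)[OF t1] by (auto intro: less_le_trans)
    next
      fix x assume x: "x \<in> {0..<t}"
      have "\<forall>\<^sub>F n in sequentially. (1 / \<beta>) ^ n < t - x" using x by (intro order_tendstoD[OF lim0]) auto
      then obtain n where "(1 / \<beta>) ^ n < t - x" using eventually_happens by force
      then show "x \<in> (\<Union>n. {0..<left_end n t})"
        using left_end_bounds(3)[OF t1, of n] x by (auto intro!: exI[of _ n])
    qed
    have sets: "{0..<left_end n t} \<in> sets unit_borel" for n
      using left_end_in[OF t1, of n] by (auto simp: sets_unit_borel_iff)
    have "(\<lambda>n. prob {0..<left_end n t}) \<longlonglongrightarrow> prob {0..<t}"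
      using finite_Lim_measure_incseq[OF _ inc] sets un by (auto simp: sets_mu)
    moreover have "(\<lambda>n. measure parry_measure {0..<left_end n t}) \<longlonglongrightarrow> measure parry_measure {0..<t}"
      using finite_measure.finite_Lim_measure_incseq[OF prob_space.finite_measure[OF prob_space_parry_measure] _ inc]
        sets un by auto
    ultimately have "(\<lambda>n. ln \<beta> - (d (left_end n t))\<^sup>2 / (32 * K ^ 3)) \<longlonglongrightarrow> ln \<beta> - (d t)\<^sup>2 / (32 * K ^ 3)"
      unfolding d_def by (intro tendsto_intros) (use K3 in auto)
    then show ?thesis
      using zero[OF left_end_in[OF t1] T_funpow_left_end_0[OF t1] Q] by (intro LIMSEQ_le_const) auto
  qed
  then show ?thesis
    unfolding ks_entropy_def d_def by (intro SUP_least) simp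
qed

end
end

section \<open>Functions of bounded variation\<close>

locale interval_discrepancy =
  fixes \<mu> \<nu> :: "real measure" and \<delta> :: real
  assumes prob: "prob_space \<mu>" "prob_space \<nu>"
    and sets_eq: "sets \<mu> = sets unit_borel" "sets \<nu> = sets unit_borel"
    and discrepancy: "\<And>t. 0 \<le> t \<Longrightarrow> t \<le> 1 \<Longrightarrow> \<bar>measure \<mu> {0..<t} - measure \<nu> {0..<t}\<bar> \<le> \<delta>"
begin

sublocale \<mu>: prob_space \<mu> by (rule prob)
sublocale \<nu>: prob_space \<nu> by (rule prob)

lemma space_eq [simp]: "space \<mu> = {0..<1}" "space \<nu> = {0..<1}"
  using sets_eq[THEN sets_eq_imp_space_eq] by simp_all

lemma delta_nonneg: "0 \<le> \<delta>"
  using discrepancy[of 0] by simp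

text \<open>A nonempty such set is \<open>[0,s)\<close> or \<open>[0,s]\<close> for its supremum
  \<open>s\<close>; the closed one is a decreasing limit of half-open ones. Sublevel sets of an
  increasing function can be of either kind.\<close>

lemma initial_segment_discrepancy:
  assumes D: "D \<subseteq> {0..<1}" and down: "\<And>x y. x \<in> D \<Longrightarrow> 0 \<le> y \<Longrightarrow> y \<le> x \<Longrightarrow> y \<in> D"
  shows "D \<in> sets unit_borel" "\<bar>measure \<mu> D - measure \<nu> D\<bar> \<le> \<delta>"
proof -
  have "D \<in> sets unit_borel \<and> \<bar>measure \<mu> D - measure \<nu> D\<bar> \<le> \<delta>"
  proof (cases "D = {}")
    case True
    then show ?thesis using delta_nonneg by simp
  next
    case False
    define s where "s = Sup D"
    have bdd: "bdd_above D" using D by (intro bdd_aboveI[of _ 1]) auto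
    obtain z where z: "z \<in> D" using False by auto
    have s01: "0 \<le> s" "s \<le> 1"
      using cSup_upper[OF z bdd] z D cSup_least[OF False, of 1] by (fastforce simp: s_def)+
    have upper: "x \<le> s" if "x \<in> D" for x
      unfolding s_def using that bdd by (rule cSup_upper)
    have lower: "x \<in> D" if "0 \<le> x" "x < s" for x
      using less_cSup_iff[OF False bdd, of x] that down by (auto simp: s_def intro: less_imp_le)
    show ?thesis
    proof (cases "s \<in> D")
      case False
      have "D = {0..<s}"
        using D upper lower False by (force simp: less_le)
      then show ?thesis using discrepancy s01 D by (auto simp: sets_unit_borel_iff)
    next
      case True
      then have s1: "s < 1" using D by auto
      have D_eq: "D = {0..s}"
      proof (intro equalityI subsetI)
        fix x assume "x \<in> {0..s}"
        then show "x \<in> D" using down[OF True] by auto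
      qed (use D upper in auto)
      \<comment> \<open>Decreases to \<open>s\<close> without exceeding 1, so that
        \<open>discrepancy\<close> applies to each \<open>t n\<close>.\<close>
      define t where "t n = s + (1 - s) * (1 / 2) ^ n" for n :: nat
      have t_lim: "t \<longlonglongrightarrow> s + (1 - s) * 0"
        unfolding t_def by (intro tendsto_intros LIMSEQ_power_zero) simp
      have t_gt: "s < t n" for n using s1 by (simp add: t_def)
      have t_le: "t n \<le> 1" for n
      proof -
        have "(1 - s) * (1 / 2) ^ n \<le> (1 - s) * 1"
          using s1 by (intro mult_left_mono power_le_one) auto
        then show ?thesis by (simp add: t_def)
      qed
      have "t (Suc n) \<le> t n" for n using s1 by (simp add: t_def mult_left_mono)
      then have dec: "decseq (\<lambda>n. {0..<t n})" unfolding decseq_Suc_iff by (auto intro: less_le_trans)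
      have Int: "(\<Inter>n. {0..<t n}) = D"
      proof (intro equalityI subsetI)
        fix x assume x: "x \<in> (\<Inter>n. {0..<t n})"
        then have "x \<le> t n" for n by (auto intro: less_imp_le)
        then have "x \<le> s" using LIMSEQ_le_const[OF t_lim, of x] by auto
        then show "x \<in> D" using x D_eq by auto
      qed (use D_eq t_gt in \<open>auto intro: le_less_trans\<close>)
      have sets: "{0..<t n} \<in> sets unit_borel" for n
        using t_le[of n] by (auto simp: sets_unit_borel_iff)
      have "(\<lambda>n. measure \<mu> {0..<t n}) \<longlonglongrightarrow> measure \<mu> D"
        using \<mu>.finite_Lim_measure_decseq[OF _ dec] sets Int sets_eq by auto
      moreover have "(\<lambda>n. measure \<nu> {0..<t n}) \<longlonglongrightarrow> measure \<nu> D"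
        using \<nu>.finite_Lim_measure_decseq[OF _ dec] sets Int sets_eq by auto
      ultimately have "(\<lambda>n. \<bar>measure \<mu> {0..<t n} - measure \<nu> {0..<t n}\<bar>) \<longlonglongrightarrow> \<bar>measure \<mu> D - measure \<nu> D\<bar>"
        by (intro tendsto_intros)
      moreover have "\<bar>measure \<mu> {0..<t n} - measure \<nu> {0..<t n}\<bar> \<le> \<delta>" for n
        using t_gt[of n] s01 t_le[of n] by (intro discrepancy) auto
      ultimately have "\<bar>measure \<mu> D - measure \<nu> D\<bar> \<le> \<delta>"
        by (intro LIMSEQ_le_const2) auto
      then show ?thesis using D_eq D by (auto simp: sets_unit_borel_iff)
    qed
  qed
  then show "D \<in> sets unit_borel" "\<bar>measure \<mu> D - measure \<nu> D\<bar> \<le> \<delta>" by auto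
qed

lemma integrable_mono_on:
  fixes f :: "real \<Rightarrow> real"
  assumes mono: "mono_on {0..<1} f" and bounds: "\<And>x. x \<in> {0..<1} \<Longrightarrow> 0 \<le> f x \<and> f x \<le> V"
    and M: "prob_space M" "sets M = sets unit_borel"
  shows "integrable M f"
proof -
  interpret M: prob_space M by (rule M)
  have "f \<in> borel_measurable M"
    using borel_measurable_mono_on_fnc[OF mono]
    by (subst measurable_cong_sets[OF M(2) refl]) (simp add: unit_borel_def)
  moreover have "norm (f x) \<le> V" if "x \<in> space M" for x
    using bounds[of x] that sets_eq_imp_space_eq[OF M(2)] by simp
  ultimately show ?thesis by (intro M.integrable_const_bound[of _ V] AE_I2)
qed

text \<open>Koksma's inequality for a monotone function, by slicing its graph into \<open>N\<close> layers.\<close>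

lemma integral_mono_on_discrepancy:
  fixes f :: "real \<Rightarrow> real"
  assumes mono: "mono_on {0..<1} f" and bounds: "\<And>x. x \<in> {0..<1} \<Longrightarrow> 0 \<le> f x \<and> f x \<le> V"
    and V: "0 < V"
  shows "\<bar>(\<integral>x. f x \<partial>\<mu>) - (\<integral>x. f x \<partial>\<nu>)\<bar> \<le> V * \<delta>"
proof -
  define U where "U c = {x \<in> {0..<1}. c \<le> f x}" for c
  have U_eq: "U c = {0..<1} - {x \<in> {0..<1}. f x < c}" for c
    by (auto simp: U_def)
  have down: "{x \<in> {0..<1}. f x < c} \<in> sets unit_borel"
    "\<bar>measure \<mu> {x \<in> {0..<1}. f x < c} - measure \<nu> {x \<in> {0..<1}. f x < c}\<bar> \<le> \<delta>" for c :: real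
  proof -
    have "y \<in> {x \<in> {0..<1}. f x < c}" if "x \<in> {x \<in> {0..<1}. f x < c}" "0 \<le> y" "y \<le> x" for x y
      using mono_onD[OF mono, of y x] that by auto
    then show "{x \<in> {0..<1}. f x < c} \<in> sets unit_borel"
      "\<bar>measure \<mu> {x \<in> {0..<1}. f x < c} - measure \<nu> {x \<in> {0..<1}. f x < c}\<bar> \<le> \<delta>"
      by (intro initial_segment_discrepancy; blast)+
  qed
  have U_sets: "U c \<in> sets unit_borel" for c
    unfolding U_eq using down(1)[of c] sets.Diff[of "{0..<1}" unit_borel] by (simp add: sets_unit_borel_iff)
  have U_disc: "\<bar>measure \<mu> (U c) - measure \<nu> (U c)\<bar> \<le> \<delta>" for c
    using down[of c] \<mu>.prob_compl[of "{x \<in> {0..<1}. f x < c}"] \<nu>.prob_compl[of "{x \<in> {0..<1}. f x < c}"]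
    unfolding U_eq by (simp add: sets_eq)
  \<comment> \<open>This is \<open>f x\<close> rounded down to a multiple of
    \<open>V / real N\<close>: it counts the positive levels reached. The \<open>N\<close> layers
    together contribute at most \<open>V * \<delta>\<close>, whatever \<open>N\<close> is.\<close>
  define h where "h N x = V / real N * (\<Sum>j=1..N. indicator (U (real j * V / real N)) x)" for N x
  have close: "\<bar>f x - h N x\<bar> \<le> V / real N" if x: "x \<in> {0..<1}" and N: "1 \<le> N" for x N
  proof -
    define m where "m = nat \<lfloor>f x * real N / V\<rfloor>"
    have fx: "0 \<le> f x" "f x \<le> V" using bounds[OF x] by auto
    have fN: "0 \<le> f x * real N / V" "f x * real N / V \<le> real N"
      using fx V N by (auto simp: divide_le_eq mult.commute mult_left_mono)
    then have m: "real m \<le> f x * real N / V" "f x * real N / V < real m + 1" "m \<le> N"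
      by (auto simp: m_def nat_le_iff floor_le_iff)
    have "indicator (U (real j * V / real N)) x = (of_bool (j \<le> m) :: real)" for j
    proof -
      have "real j * V / real N \<le> f x \<longleftrightarrow> real j \<le> f x * real N / V"
        using V N by (simp add: field_simps)
      also have "\<dots> \<longleftrightarrow> j \<le> m" using m by linarith
      finally show ?thesis using x by (simp add: U_def indicator_def)
    qed
    then have "(\<Sum>j=1..N. indicator (U (real j * V / real N)) x) = real (card {j \<in> {1..N}. j \<le> m})"
      by (simp add: of_bool_def sum.If_cases Int_def)
    also have "{j \<in> {1..N}. j \<le> m} = {1..m}" using m by auto
    finally have h: "h N x = V / real N * real m" by (simp add: h_def)
    have "V / real N * real m \<le> V / real N * (f x * real N / V)"
      using m V by (intro mult_left_mono) auto
    moreover have "V / real N * (f x * real N / V) \<le> V / real N * (real m + 1)"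
      using m V by (intro mult_left_mono) auto
    moreover have "V / real N * (f x * real N / V) = f x" using V N by simp
    ultimately show ?thesis unfolding h by (simp add: distrib_left)
  qed
  have layer: "\<bar>(\<integral>x. f x \<partial>M) - V / real N * (\<Sum>j=1..N. measure M (U (real j * V / real N)))\<bar> \<le> V / real N"
    if M: "prob_space M" "sets M = sets unit_borel" and N: "1 \<le> N" for M N
  proof -
    interpret M: prob_space M by (rule M)
    have sp: "space M = {0..<1}" using sets_eq_imp_space_eq[OF M(2)] by simp
    have int_ind: "integrable M (indicator (U c) :: real \<Rightarrow> real)" for c
      using U_sets M by (simp add: integrable_indicator_iff less_top[symmetric])
    have int_h: "integrable M (h N)"
      unfolding h_def[abs_def] using int_ind by (intro integrable_mult_right Bochner_Integration.integrable_sum)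
    have int_f: "integrable M f" by (rule integrable_mono_on[OF mono bounds M])
    have "(\<integral>x. h N x \<partial>M) = V / real N * (\<Sum>j=1..N. measure M (U (real j * V / real N)))"
      unfolding h_def using int_ind U_sets M by (simp add: Bochner_Integration.integral_sum)
    then have "\<bar>(\<integral>x. f x \<partial>M) - V / real N * (\<Sum>j=1..N. measure M (U (real j * V / real N)))\<bar>
        = \<bar>\<integral>x. f x - h N x \<partial>M\<bar>"
      using int_f int_h by simp
    also have "\<dots> \<le> (\<integral>x. \<bar>f x - h N x\<bar> \<partial>M)" by (rule integral_abs_bound)
    also have "\<dots> \<le> (\<integral>x. V / real N \<partial>M)"
      using int_f int_h close N by (intro integral_mono) (auto simp: sp)
    finally show ?thesis using M.prob_space by simp
  qed
  have "\<bar>(\<integral>x. f x \<partial>\<mu>) - (\<integral>x. f x \<partial>\<nu>)\<bar> \<le> V * \<delta> + 2 * (V / real N)" if N: "1 \<le> N" for N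
  proof -
    let ?S = "\<lambda>M. V / real N * (\<Sum>j=1..N. measure M (U (real j * V / real N)))"
    have "\<bar>?S \<mu> - ?S \<nu>\<bar> = V / real N * \<bar>\<Sum>j=1..N. measure \<mu> (U (real j * V / real N)) - measure \<nu> (U (real j * V / real N))\<bar>"
      unfolding right_diff_distrib[symmetric] sum_subtractf[symmetric] abs_mult using V by simp
    also have "\<dots> \<le> V / real N * (\<Sum>j=1..N. \<delta>)"
      using V U_disc by (intro mult_left_mono order_trans[OF sum_abs] sum_mono) auto
    also have "\<dots> = V * \<delta>" using N by simp
    finally show ?thesis
      using layer[OF prob(1) sets_eq(1) N] layer[OF prob(2) sets_eq(2) N] by linarith
  qed
  moreover have "(\<lambda>N. V * \<delta> + 2 * (V / real N)) \<longlonglongrightarrow> V * \<delta> + 2 * 0"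
    by (intro tendsto_intros lim_const_over_n)
  ultimately show ?thesis
    using LIMSEQ_le_const[of "\<lambda>N. V * \<delta> + 2 * (V / real N)" "V * \<delta>"] by auto
qed

end

section \<open>Variation on initial segments and the Jordan decomposition\<close>

definition variation_sums :: "(real \<Rightarrow> real) \<Rightarrow> real set \<Rightarrow> real set" where
  "variation_sums f S =
     {\<Sum>i<n. \<bar>f (p i) - f (p (Suc i))\<bar> | n p. strict_mono_on {..n} p \<and> p ` {..n} \<subseteq> S}"

lemma variation_sums_extend:
  fixes f p :: "_ \<Rightarrow> real"
  assumes "strict_mono_on {..n} p" "p ` {..n} \<subseteq> S" "p n < y" "y \<in> S"
  defines "q \<equiv> p(Suc n := y)"
  shows "strict_mono_on {..Suc n} q" "q ` {..Suc n} \<subseteq> S"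
    "(\<Sum>i<Suc n. \<bar>f (q i) - f (q (Suc i))\<bar>) = (\<Sum>i<n. \<bar>f (p i) - f (p (Suc i))\<bar>) + \<bar>f (p n) - f y\<bar>"
proof -
  have le: "p i \<le> p n" if "i \<le> n" for i
    using strict_mono_onD[OF assms(1), of i n] that by (cases "i = n") auto
  show "strict_mono_on {..Suc n} q"
  proof (rule strict_mono_onI)
    fix i j assume ij: "i \<in> {..Suc n}" "j \<in> {..Suc n}" "i < j"
    show "q i < q j"
    proof (cases "j = Suc n")
      case True
      then show ?thesis using ij le[of i] assms(3) by (simp add: q_def)
    next
      case False
      then show ?thesis using ij strict_mono_onD[OF assms(1), of i j] by (simp add: q_def)
    qed
  qed
  show "q ` {..Suc n} \<subseteq> S" using assms(2,4) by (auto simp: q_def le_Suc_eq)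
  have "(\<Sum>i<n. \<bar>f (q i) - f (q (Suc i))\<bar>) = (\<Sum>i<n. \<bar>f (p i) - f (p (Suc i))\<bar>)"
    by (intro sum.cong) (auto simp: q_def)
  then show "(\<Sum>i<Suc n. \<bar>f (q i) - f (q (Suc i))\<bar>) = (\<Sum>i<n. \<bar>f (p i) - f (p (Suc i))\<bar>) + \<bar>f (p n) - f y\<bar>"
    by (simp add: q_def)
qed

text \<open>A chain ending at \<open>x\<close> is extended by \<open>y\<close>. One that stops short
  of \<open>x\<close> is first extended by \<open>x\<close>, which can only increase its
  sum.\<close>

lemma variation_sums_add:
  assumes "a \<in> variation_sums f {0..x}" "x < y" "0 \<le> x"
  shows "\<exists>b\<in>variation_sums f {0..y}. a + \<bar>f y - f x\<bar> \<le> b"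
proof -
  obtain n p where p: "strict_mono_on {..n} p" "p ` {..n} \<subseteq> {0..x}"
    and a: "a = (\<Sum>i<n. \<bar>f (p i) - f (p (Suc i))\<bar>)"
    using assms(1) by (auto simp: variation_sums_def)
  have pn: "p n \<le> x" using p(2) by auto
  show ?thesis
  proof (cases "p n = x")
    case True
    have sub: "p ` {..n} \<subseteq> {0..y}" using p(2) assms(2) by force
    show ?thesis
    proof (intro bexI)
      have py: "p n < y" "y \<in> {0..y}" using True assms by auto
      note q = variation_sums_extend(1,2)[OF p(1) sub py]
        and sum = variation_sums_extend(3)[OF p(1) sub py, of f]
      show "a + \<bar>f y - f x\<bar> \<le> (\<Sum>i<n. \<bar>f (p i) - f (p (Suc i))\<bar>) + \<bar>f (p n) - f y\<bar>"
        using True a by (simp add: abs_minus_commute)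
      show "(\<Sum>i<n. \<bar>f (p i) - f (p (Suc i))\<bar>) + \<bar>f (p n) - f y\<bar> \<in> variation_sums f {0..y}"
        unfolding sum[symmetric] variation_sums_def using q by blast
    qed
  next
    case False
    then have pn: "p n < x" using pn by simp
    let ?q = "p(Suc n := x)" and ?r = "p(Suc n := x, Suc (Suc n) := y)"
    have sub: "p ` {..n} \<subseteq> {0..y}" using p(2) assms(2) by force
    have xy: "x \<in> {0..y}" "y \<in> {0..y}" using assms by auto
    note q = variation_sums_extend(1,2)[OF p(1) sub pn xy(1)]
      and q_sum = variation_sums_extend(3)[OF p(1) sub pn xy(1), of f]
    have qy: "?q (Suc n) < y" using assms by simp
    note r = variation_sums_extend(1,2)[OF q qy xy(2)]
      and r_sum = variation_sums_extend(3)[OF q qy xy(2), of f]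
    have "(\<Sum>i<Suc (Suc n). \<bar>f (?r i) - f (?r (Suc i))\<bar>) = a + \<bar>f (p n) - f x\<bar> + \<bar>f x - f y\<bar>"
      unfolding r_sum q_sum a by simp
    moreover have "(\<Sum>i<Suc (Suc n). \<bar>f (?r i) - f (?r (Suc i))\<bar>) \<in> variation_sums f {0..y}"
      unfolding variation_sums_def using r by blast
    ultimately show ?thesis by (intro bexI) (auto simp: abs_minus_commute)
  qed
qed

text \<open>\<open>v\<close> is the variation up to \<open>x\<close>. The first property makes both
  \<open>v\<close> and \<open>v - f\<close> increasing, so it contains the whole
  decomposition.\<close>

lemma jordan_decomposition:
  assumes "variation f < \<infinity>"
  defines "V \<equiv> enn2real (variation f)"
  obtains v where "\<And>x y. 0 \<le> x \<Longrightarrow> x \<le> y \<Longrightarrow> y < 1 \<Longrightarrow> v x + \<bar>f y - f x\<bar> \<le> v y"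
    "\<And>x. x \<in> {0..<1} \<Longrightarrow> 0 \<le> v x \<and> v x \<le> V"
proof -
  define v where "v x = Sup (variation_sums f {0..x})" for x
  have le_V: "a \<le> V" if a: "a \<in> variation_sums f {0..x}" and x: "x < 1" for a x
  proof -
    obtain n p where p: "strict_mono_on {..n} p" "p ` {..n} \<subseteq> {0..x}"
      and a: "a = (\<Sum>i<n. \<bar>f (p i) - f (p (Suc i))\<bar>)"
      using a by (auto simp: variation_sums_def)
    have "p ` {..n} \<subseteq> {0..<1}" using p(2) x by force
    then have "ennreal a \<le> variation f"
      unfolding variation_def a using p(1) by (intro SUP_upper2[of "(n, p)"]) auto
    also have "\<dots> = ennreal V" using assms(1) by (simp add: V_def)
    finally show ?thesis by (simp add: V_def ennreal_le_iff)
  qed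
  then have bdd: "bdd_above (variation_sums f {0..x})" if "x < 1" for x
    using that by (intro bdd_aboveI[of _ V])
  \<comment> \<open>The one-point chain has an empty sum; it shows that the supremum is over a
    nonempty set.\<close>
  have zero: "0 \<in> variation_sums f {0..x}" if "0 \<le> x" for x
    unfolding variation_sums_def using that
    by (auto intro!: exI[of _ 0] exI[of _ "\<lambda>_. x"] simp: strict_mono_on_def)
  show thesis
  proof (rule that[of v])
    fix x assume x: "x \<in> {0..<1::real}"
    show "0 \<le> v x \<and> v x \<le> V"
      unfolding v_def using x zero[of x] bdd[of x] le_V[of _ x]
      by (auto intro!: cSup_upper cSup_least)
  next
    fix x y :: real assume xy: "0 \<le> x" "x \<le> y" "y < 1"
    show "v x + \<bar>f y - f x\<bar> \<le> v y"
    proof (cases "x = y")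
      case False
      have "a \<le> v y - \<bar>f y - f x\<bar>" if a: "a \<in> variation_sums f {0..x}" for a
      proof -
        obtain b where b: "b \<in> variation_sums f {0..y}" "a + \<bar>f y - f x\<bar> \<le> b"
          using variation_sums_add[OF a, of y] xy False by auto
        then show ?thesis using cSup_upper[OF b(1) bdd[OF xy(3)]] by (simp add: v_def)
      qed
      then have "v x \<le> v y - \<bar>f y - f x\<bar>"
        unfolding v_def[of x] using zero[OF xy(1)] by (intro cSup_least) auto
      then show ?thesis by simp
    qed simp
  qed
qed

text \<open>Up to a constant \<open>f\<close> is \<open>v - u\<close> with \<open>v\<close> and
  \<open>u\<close> increasing, \<open>v\<close> in \<open>[0,V]\<close> and \<open>u\<close> in
  \<open>[0,2V]\<close>; hence the factor \<open>1 + 2\<close>. Constants cancel because both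
  measures are probabilities.\<close>

lemma (in interval_discrepancy) integral_bv_discrepancy:
  assumes f: "bv_norm f < \<infinity>"
  shows "\<bar>(\<integral>x. f x \<partial>\<mu>) - (\<integral>x. f x \<partial>\<nu>)\<bar> \<le> 3 * enn2real (bv_norm f) * \<delta>"
proof -
  have var_le: "variation f \<le> bv_norm f" by (simp add: bv_norm_def)
  then have var: "variation f < \<infinity>" using f by (rule le_less_trans)
  define V where "V = enn2real (variation f)"
  have V: "0 \<le> V" "V \<le> enn2real (bv_norm f)"
    using var_le f by (simp_all add: V_def enn2real_mono)
  obtain v where v: "\<And>x y. 0 \<le> x \<Longrightarrow> x \<le> y \<Longrightarrow> y < 1 \<Longrightarrow> v x + \<bar>f y - f x\<bar> \<le> v y"
    "\<And>x. x \<in> {0..<1} \<Longrightarrow> 0 \<le> v x \<and> v x \<le> V"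
    by (rule jordan_decomposition[OF var, folded V_def], rule that)
  define u where "u x = v x - f x - (v 0 - f 0)" for x
  have u: "mono_on {0..<1} u" "\<And>x. x \<in> {0..<1} \<Longrightarrow> 0 \<le> u x \<and> u x \<le> 2 * V"
  proof -
    show "mono_on {0..<1} u"
    proof (rule mono_onI)
      fix x y :: real assume "x \<in> {0..<1}" "y \<in> {0..<1}" "x \<le> y"
      then show "u x \<le> u y" using v(1)[of x y] unfolding u_def by auto
    qed
    fix x :: real assume "x \<in> {0..<1}"
    then show "0 \<le> u x \<and> u x \<le> 2 * V"
      using v(1)[of 0 x] v(2)[of x] v(2)[of 0] unfolding u_def by auto
  qed
  have v_mono: "mono_on {0..<1} v"
  proof (rule mono_onI)
    fix x y :: real assume "x \<in> {0..<1}" "y \<in> {0..<1}" "x \<le> y"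
    then show "v x \<le> v y" using v(1)[of x y] by auto
  qed
  define c where "c = v 0 - f 0"
  have f_eq: "f x = v x - u x - c" for x by (simp add: u_def c_def)
  have split: "(\<integral>x. f x \<partial>M) = (\<integral>x. v x \<partial>M) - (\<integral>x. u x \<partial>M) - c"
    if M: "prob_space M" "sets M = sets unit_borel" for M
  proof -
    interpret M: prob_space M by (rule M)
    have "(\<integral>x. f x \<partial>M) = (\<integral>x. v x - u x - c \<partial>M)" by (simp only: f_eq)
    then show ?thesis
      using integrable_mono_on[OF v_mono v(2) M] integrable_mono_on[OF u M] M.prob_space by simp
  qed
  \<comment> \<open>The monotone case asks for a positive bound, but \<open>V\<close> is 0 for
    constant \<open>f\<close>; hence a slightly larger \<open>W\<close>.\<close>
  have bound: "\<bar>(\<integral>x. v x \<partial>\<mu>) - (\<integral>x. v x \<partial>\<nu>)\<bar> \<le> W * \<delta> \<and> \<bar>(\<integral>x. u x \<partial>\<mu>) - (\<integral>x. u x \<partial>\<nu>)\<bar> \<le> 2 * W * \<delta>"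
    if W: "V < W" for W
  proof
    show "\<bar>(\<integral>x. v x \<partial>\<mu>) - (\<integral>x. v x \<partial>\<nu>)\<bar> \<le> W * \<delta>"
      using v_mono v(2) W V by (intro integral_mono_on_discrepancy) (auto intro: order_trans[OF _ less_imp_le])
    show "\<bar>(\<integral>x. u x \<partial>\<mu>) - (\<integral>x. u x \<partial>\<nu>)\<bar> \<le> 2 * W * \<delta>"
      using u W V by (intro integral_mono_on_discrepancy) force+
  qed
  have "\<bar>(\<integral>x. f x \<partial>\<mu>) - (\<integral>x. f x \<partial>\<nu>)\<bar> \<le> 3 * V * \<delta> + e" if e: "0 < e" for e
  proof -
    \<comment> \<open>The excess \<open>3 * (W - V) * \<delta>\<close> is at most \<open>e\<close>;
      the added 1 covers \<open>\<delta> = 0\<close>.\<close>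
    define W where "W = V + e / (3 * (\<delta> + 1))"
    have W: "V < W" using e delta_nonneg by (simp add: W_def)
    have "3 * (W - V) * \<delta> = e * (\<delta> / (\<delta> + 1))"
      using delta_nonneg by (simp add: W_def field_simps)
    also have "\<dots> \<le> e * 1"
      using e delta_nonneg by (intro mult_left_mono) (auto simp: divide_le_eq)
    finally have "3 * W * \<delta> \<le> 3 * V * \<delta> + e" by (simp add: algebra_simps)
    moreover have "\<bar>(\<integral>x. f x \<partial>\<mu>) - (\<integral>x. f x \<partial>\<nu>)\<bar> \<le> 3 * W * \<delta>"
      unfolding split[OF prob(1) sets_eq(1)] split[OF prob(2) sets_eq(2)] using bound[OF W] by (simp add: abs_le_iff)
    ultimately show ?thesis by linarith
  qed
  then have "\<bar>(\<integral>x. f x \<partial>\<mu>) - (\<integral>x. f x \<partial>\<nu>)\<bar> \<le> 3 * V * \<delta>" by (rule field_le_epsilon)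
  also have "\<dots> \<le> 3 * enn2real (bv_norm f) * \<delta>"
    using V delta_nonneg by (intro mult_right_mono) auto
  finally show ?thesis .
qed

text \<open>Pushed forward to the real line by the identity, the measures become distributions,
  which their distribution functions determine.\<close>

lemma eq_if_interval_discrepancy_0:
  assumes "interval_discrepancy \<mu> \<nu> 0"
  shows "\<mu> = \<nu>"
proof -
  interpret interval_discrepancy \<mu> \<nu> 0 by (rule assms)
  have id_meas: "(\<lambda>x. x) \<in> borel_measurable M" if "sets M = sets unit_borel" for M
    by (rule measurable_unit_borelI[OF that]) simp
  have rd: "real_distribution (distr M borel (\<lambda>x. x))" if "prob_space M" "sets M = sets unit_borel" for M
    using prob_space.prob_space_distr[OF that(1) id_meas[OF that(2)]]
    by (simp add: real_distribution_def real_distribution_axioms_def)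
  have "cdf (distr \<mu> borel (\<lambda>x. x)) = cdf (distr \<nu> borel (\<lambda>x. x))"
  proof
    fix x
    have "measure \<mu> ({..x} \<inter> {0..<1}) = measure \<nu> ({..x} \<inter> {0..<1})"
      using initial_segment_discrepancy(2)[of "{..x} \<inter> {0..<1}"] by auto
    then show "cdf (distr \<mu> borel (\<lambda>x. x)) x = cdf (distr \<nu> borel (\<lambda>x. x)) x"
      using id_meas sets_eq by (simp add: cdf_def measure_distr)
  qed
  then have eq: "distr \<mu> borel (\<lambda>x. x) = distr \<nu> borel (\<lambda>x. x)"
    using rd prob sets_eq by (intro cdf_unique) auto
  show ?thesis
  proof (rule measure_eqI)
    fix A assume "A \<in> sets \<mu>"
    then have A: "A \<subseteq> {0..<1}" "A \<in> sets borel" by (simp_all add: sets_eq sets_unit_borel_iff)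
    have "emeasure (distr M borel (\<lambda>x. x)) A = emeasure M A"
      if "sets M = sets unit_borel" for M
      using that A sets_eq_imp_space_eq[OF that] id_meas[OF that] by (simp add: emeasure_distr Int_absorb2)
    then show "emeasure \<mu> A = emeasure \<nu> A" using eq sets_eq by metis
  qed (simp add: sets_eq)
qed

section \<open>The measure of maximal entropy and the final estimate\<close>

context beta_transformation
begin

text \<open>The entropy is an extended real. The rate of the digit partition bounds it from below
  and \<open>entropy_discrepancy\<close> from above, so it is a real number; only then can the
  quadratic bound be solved for the discrepancy.\<close>

lemma ks_entropy_finite:
  assumes inv: "\<mu> \<in> invariant_measures unit_borel T"
  obtains r where "ks_entropy T \<mu> = ereal r" "r \<le> ln \<beta>"
    "interval_discrepancy \<mu> parry_measure (sqrt (32 * K ^ 3) * sqrt (ln \<beta> - r))"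
proof -
  have M: "prob_space \<mu>" "sets \<mu> = sets unit_borel" using inv by (auto simp: invariant_measures_def)
  have "ereal (partition_entropy_rate \<mu> T digit_partition) \<le> ks_entropy T \<mu>"
    unfolding ks_entropy_def using digit_partition_measurable[OF M(2)] by (rule SUP_upper)
  moreover note entropy_discrepancy[OF inv, of 0]
  ultimately obtain r where r: "ks_entropy T \<mu> = ereal r"
    by (cases "ks_entropy T \<mu>") auto
  have K3: "0 < K ^ 3" using K_gt_1 by simp
  have d: "r \<le> ln \<beta> - (measure \<mu> {0..<t} - measure parry_measure {0..<t})\<^sup>2 / (32 * K ^ 3)"
    if "0 \<le> t" "t \<le> 1" for t
    using entropy_discrepancy[OF inv that] unfolding r by simp
  have "interval_discrepancy \<mu> parry_measure (sqrt (32 * K ^ 3) * sqrt (ln \<beta> - r))"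
  proof (rule interval_discrepancy.intro)
    fix t :: real assume t: "0 \<le> t" "t \<le> 1"
    have "(measure \<mu> {0..<t} - measure parry_measure {0..<t})\<^sup>2 \<le> 32 * K ^ 3 * (ln \<beta> - r)"
      using d[OF t] K3 by (simp add: field_simps)
    then have "sqrt ((measure \<mu> {0..<t} - measure parry_measure {0..<t})\<^sup>2) \<le> sqrt (32 * K ^ 3 * (ln \<beta> - r))"
      by (rule real_sqrt_le_mono)
    then show "\<bar>measure \<mu> {0..<t} - measure parry_measure {0..<t}\<bar> \<le> sqrt (32 * K ^ 3) * sqrt (ln \<beta> - r)"
      by (simp add: real_sqrt_mult)
  qed (simp_all add: M prob_space_parry_measure)
  moreover have "r \<le> ln \<beta>" using d[of 0] by simp
  ultimately show thesis by (intro that[OF r])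
qed

lemma topological_entropy_beta: "topological_entropy unit_borel T = ereal (ln \<beta>)"
proof (rule antisym)
  show "topological_entropy unit_borel T \<le> ereal (ln \<beta>)"
    unfolding topological_entropy_def
  proof (rule SUP_least)
    fix M assume "M \<in> invariant_measures unit_borel T"
    then show "ks_entropy T M \<le> ereal (ln \<beta>)" by (rule ks_entropy_finite) simp
  qed
  show "ereal (ln \<beta>) \<le> topological_entropy unit_borel T"
    unfolding topological_entropy_def using parry_measure_invariant parry_entropy_ge by (rule SUP_upper2)
qed

lemma max_entropy_measure_beta: "max_entropy_measure unit_borel T = parry_measure"
  unfolding max_entropy_measure_def
proof (rule the_equality)
  show "parry_measure \<in> invariant_measures unit_borel T \<and> ks_entropy T parry_measure = topological_entropy unit_borel T"
    using parry_measure_invariant parry_entropy_ge SUP_upper[OF parry_measure_invariant, of "ks_entropy T"]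
    by (auto simp: topological_entropy_beta[symmetric] topological_entropy_def intro!: antisym)
next
  fix M assume M: "M \<in> invariant_measures unit_borel T \<and> ks_entropy T M = topological_entropy unit_borel T"
  then have "M \<in> invariant_measures unit_borel T" by blast
  then show "M = parry_measure"
  proof (rule ks_entropy_finite)
    fix r assume r: "ks_entropy T M = ereal r"
      and d: "interval_discrepancy M parry_measure (sqrt (32 * K ^ 3) * sqrt (ln \<beta> - r))"
    \<comment> \<open>Maximal entropy makes the discrepancy bound 0, which identifies the measure
      and so justifies the definite description.\<close>
    have "r = ln \<beta>" using M r by (simp add: topological_entropy_beta)
    then show "M = parry_measure" using d eq_if_interval_discrepancy_0 by simp
  qed
qed

end

theorem corollary1p5:
  fixes \<beta> :: real
  assumes "\<beta> > 1"
  shows "\<exists>C\<^sub>0::real. C\<^sub>0 > 0 \<and>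
    (\<forall>\<mu> \<in> invariant_measures unit_borel (beta_map \<beta>). \<forall>f :: real \<Rightarrow> real. bv_norm f < \<infinity> \<longrightarrow>
      \<bar>(\<integral>x. f x \<partial>\<mu>) - (\<integral>x. f x \<partial>max_entropy_measure unit_borel (beta_map \<beta>))\<bar>
        \<le> C\<^sub>0 * enn2real (bv_norm f) *
            sqrt (real_of_ereal (topological_entropy unit_borel (beta_map \<beta>)
                                 - ks_entropy (beta_map \<beta>) \<mu>)))"
proof -
  interpret beta_transformation \<beta> by unfold_locales (rule assms)
  \<comment> \<open>The 3 comes from the Jordan decomposition, the root from the optimal
    tilt.\<close>
  let ?C = "3 * sqrt (32 * K ^ 3)"
  have "\<bar>(\<integral>x. f x \<partial>\<mu>) - (\<integral>x. f x \<partial>max_entropy_measure unit_borel T)\<bar>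
      \<le> ?C * enn2real (bv_norm f) * sqrt (real_of_ereal (topological_entropy unit_borel T - ks_entropy T \<mu>))"
    if \<mu>: "\<mu> \<in> invariant_measures unit_borel T" and f: "bv_norm f < \<infinity>" for \<mu> f
    using \<mu>
  proof (rule ks_entropy_finite)
    fix r assume r: "ks_entropy T \<mu> = ereal r"
      and d: "interval_discrepancy \<mu> parry_measure (sqrt (32 * K ^ 3) * sqrt (ln \<beta> - r))"
    show ?thesis
      using interval_discrepancy.integral_bv_discrepancy[OF d f]
      by (simp add: max_entropy_measure_beta topological_entropy_beta r mult_ac)
  qed
  moreover have "0 < ?C" using K_gt_1 by simp
  ultimately show ?thesis by blast
qed

end
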